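(* Let $p \in [1,+\infty)$ and $\gamma \in (0,+\infty)$. There exists a constant $C_{p,\gamma} > 0$ such that for any $n \ge 2$ and any $\mathbf{X} \in M_n$ (with $s(\mathbf{X})>0$) satisfying $\|\mathbf{X}\|_{\infty} \le \gamma$, $$D(\mathbf{X}) \le C_{p,\gamma} \left[ \frac{n \log(n)}{s^3(\mathbf{X})} + \left( \|V^2(\mathbf{X})-1\|_p^p + s^{-2p}(\mathbf{X}) \right)^{1/(2p+1)} \right].$$
   Context: $M_n$ denotes the set of all square-integrable martingale difference sequences of length $n$, i.e. sequences $\mathbf{X} = (X_1,\ldots,X_n)$ of square-integrable real random variables (on some probability space) such that $\mathbb{E}[X_i \mid \mathcal{F}_{i-1}] = 0$ for every $1\le i\le n$, where $\mathcal{F}_i$ is the $\sigma$-algebra generated by $(X_1,\ldots,X_i)$ ($\mathcal{F}_0$ trivial). For $\mathbf{X}\in M_n$ define $$s^2(\mathbf{X}) = \sum_{i=1}^n \mathbb{E}[X_i^2], \qquad V^2(\mathbf{X}) = s^{-2}(\mathbf{X}) \sum_{i=1}^n \mathbb{E}[X_i^2 \mid \mathcal{F}_{i-1}], \qquad S(\mathbf{X}) = \sum_{i=1}^n X_i,$$ with $s(\mathbf{X})\ge 0$ the square root of $s^2(\mathbf{X})$, and powers $s^a(\mathbf{X}) = (s(\mathbf{X}))^a$. Let $\Phi(t) = (2\pi)^{-1/2}\int_{-\infty}^t e^{-x^2/2}\,dx$ and $$D(\mathbf{X}) = \sup_{t\in\mathbb{R}} \left| \mathbb{P}[S(\mathbf{X})/s(\mathbf{X})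 \le t] - \Phi(t) \right|.$$ For a random variable $Y$, $\|Y\|_p$ is its $L^p$ norm, and for a sequence, $\|\mathbf{X}\|_p = \max_{1\le i\le n} \|X_i\|_p$ for $p\in[1,+\infty]$. *)

theory Defs
  imports "HOL-Probability.Probability"
begin

text \<open>
  A sequence of length \<open>n\<close> is a function \<open>X :: nat \<Rightarrow> 'a \<Rightarrow> real\<close> of which only
  \<open>X 1, \<dots>, X n\<close> matter.
\<close>

text \<open>For \<open>i = 0\<close> the generating family is empty and the sigma-algebra is trivial.\<close>

definition gen_sigma :: "'a measure \<Rightarrow> (nat \<Rightarrow> 'a \<Rightarrow> real) \<Rightarrow> nat \<Rightarrow> 'a measure" where
  "gen_sigma M X i =
     sigma (space M) {X j -` A \<inter> space M | j A. j \<in> {1..i} \<and> A \<in> sets borel}"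

definition mart_diff :: "'a measure \<Rightarrow> nat \<Rightarrow> (nat \<Rightarrow> 'a \<Rightarrow> real) \<Rightarrow> bool" where
  "mart_diff M n X \<longleftrightarrow>
     prob_space M \<and>
     (\<forall>i\<in>{1..n}. X i \<in> borel_measurable M \<and> integrable M (\<lambda>\<omega>. (X i \<omega>)\<^sup>2)) \<and>
     (\<forall>i\<in>{1..n}. AE \<omega> in M. real_cond_exp M (gen_sigma M X (i - 1)) (X i) \<omega> = 0)"

definition s2 :: "'a measure \<Rightarrow> nat \<Rightarrow> (nat \<Rightarrow> 'a \<Rightarrow> real) \<Rightarrow> real" where
  "s2 M n X = (\<Sum>i\<in>{1..n}. \<integral>\<omega>. (X i \<omega>)\<^sup>2 \<partial>M)"

definition s_norm :: "'a measure \<Rightarrow> nat \<Rightarrow> (nat \<Rightarrow> 'a \<Rightarrow> real) \<Rightarrow> real" where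
  "s_norm M n X = sqrt (s2 M n X)"

definition V2 :: "'a measure \<Rightarrow> nat \<Rightarrow> (nat \<Rightarrow> 'a \<Rightarrow> real) \<Rightarrow> 'a \<Rightarrow> real" where
  "V2 M n X \<omega> =
     (\<Sum>i\<in>{1..n}. real_cond_exp M (gen_sigma M X (i - 1)) (\<lambda>\<omega>'. (X i \<omega>')\<^sup>2) \<omega>) / s2 M n X"

definition S_sum :: "nat \<Rightarrow> (nat \<Rightarrow> 'a \<Rightarrow> real) \<Rightarrow> 'a \<Rightarrow> real" where
  "S_sum n X \<omega> = (\<Sum>i\<in>{1..n}. X i \<omega>)"

definition D_dist :: "'a measure \<Rightarrow> nat \<Rightarrow> (nat \<Rightarrow> 'a \<Rightarrow> real) \<Rightarrow> real" where
  "D_dist M n X =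
     (SUP t::real. \<bar>measure M {\<omega> \<in> space M. S_sum n X \<omega> / s_norm M n X \<le> t} - cdf std_normal_distribution t\<bar>)"

text \<open>
  The norm below is the \<open>L\<^sup>p\<close> norm for finite \<open>p\<close> and functions with \<open>\<bar>f\<bar>\<close> to the power \<open>p\<close>
  integrable (otherwise the Bochner integral is \<open>0\<close>). It is applied only to \<open>V2 M n X - 1\<close>
  for a bounded sequence \<open>X\<close>, which is almost surely bounded.
\<close>

definition Lp_norm :: "real \<Rightarrow> 'a measure \<Rightarrow> ('a \<Rightarrow> real) \<Rightarrow> real" where
  "Lp_norm p M f = (\<integral>\<omega>. \<bar>f \<omega>\<bar> powr p \<partial>M) powr (1 / p)"

definition Linf_norm :: "'a measure \<Rightarrow> ('a \<Rightarrow> real) \<Rightarrow> ereal" where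
  "Linf_norm M f = esssup M (\<lambda>\<omega>. ereal \<bar>f \<omega>\<bar>)"

definition seq_Linf_norm :: "'a measure \<Rightarrow> nat \<Rightarrow> (nat \<Rightarrow> 'a \<Rightarrow> real) \<Rightarrow> ereal" where
  "seq_Linf_norm M n X = Max ((\<lambda>i. Linf_norm M (X i)) ` {1..n})"

text \<open>
  \<open>C\<close> is a valid constant for all sequences of all lengths \<open>n \<ge> 2\<close> on all probability spaces
  whose sample points have type \<open>'a\<close>.
\<close>

definition rate_bound :: "'a itself \<Rightarrow> real \<Rightarrow> real \<Rightarrow> real \<Rightarrow> bool" where
  "rate_bound (_ :: 'a itself) p \<gamma> C \<longleftrightarrow>
     (\<forall>n\<ge>2. \<forall>(M :: 'a measure) X.
        mart_diff M n X \<longrightarrow> s_norm M n X > 0 \<longrightarrow> seq_Linf_norm M n X \<le> ereal \<gamma> \<longrightarrow>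
        D_dist M n X \<le> C * (real n * ln (real n) / s_norm M n X ^ 3 +
          (Lp_norm p M (\<lambda>\<omega>. V2 M n X \<omega> - 1) powr p + s_norm M n X powr (- 2 * p))
            powr (1 / (2 * p + 1))))"

text \<open>
  HOL cannot quantify over types inside a formula, so in \<open>\<exists>C>0. rate_bound TYPE('a) p \<gamma> C\<close> with
  a type variable \<open>'a\<close> the constant could depend on the sample space type. To express one
  constant for all probability spaces, one asserts that a constant exists for the fixed type
  \<open>nat \<Rightarrow> real\<close> of real sequences, and that every constant valid there is valid for
  every type \<open>'a\<close>.
\<close>

end

theory Submission
  imports Defs
begin

text \<open>
  The proof is Lindeberg's exchange argument in the form given to it by Bolthausen. It yields
  the bound \<open>D(X) \<le> C x\<close> with \<open>x = (\<parallel>V\<^sup>2 - 1\<parallel>\<^sub>p\<^sup>p + s\<^sup>-\<^sup>2\<^sup>p)\<^bsup>1/(2p+1)\<^esup>\<close>; the summand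
  \<open>n log n / s\<^sup>3\<close> is nonnegative, so this implies the claim.

  Stop the martingale before its conditional variance \<open>Q\<close> exceeds \<open>B = s\<^sup>2 (1 + x\<^sup>2)\<close>. By
  Markov's inequality \<open>\<bar>V\<^sup>2 - 1\<bar> \<ge> x\<^sup>2\<close> has probability at most \<open>x\<close>, so stopping changes
  the distribution function of the sum by at most \<open>x\<close>. Let \<open>S\<close> be the stopped sum and let \<open>k\<close>
  be a large multiple of \<open>\<gamma>\<close>. Complete \<open>S\<close> by an independent centred normal variable of
  conditional variance \<open>L = B + k\<^sup>2 - Q\<close>, which makes the total variance deterministic.
  The probability that the completed sum is at most \<open>t\<close> is the expectation of
  \<open>heat (t - S) L\<close>, where \<open>heat r L = \<Phi>(r / \<surd>L)\<close>. As \<open>heat\<close> solves the heat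
  equation, one step of the martingale changes the expectation of \<open>heat (t - S) L\<close> by
  third-order terms only, of size \<open>\<gamma> v W\<^sup>-\<^sup>3\<close> with \<open>v\<close> the conditional variance of the step
  and \<open>W\<^sup>2 = 2 L + (t - S)\<^sup>2\<close>.

  To sum these errors, use the function \<open>potential (t - S) L = 1 / W\<close>. Up to
  third-order errors, its conditional expectation increases in each step by at least
  \<open>v W\<^sup>-\<^sup>3 / 2\<close>. The errors of all steps together are therefore bounded by a multiple of
  \<open>\<gamma>\<close> times the expectation of \<open>potential (t - S) L\<close> at the terminal time
  (\<open>heat_le_potential\<close>). There the potential is at most \<open>min (1/k) (1/\<bar>t - S\<bar>)\<close>, and a
  dyadic decomposition bounds its expectation by \<open>O(log s / s + \<delta> / k)\<close>, where \<open>\<delta>\<close> is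
  the Kolmogorov distance of \<open>S / s\<close> from the normal law (\<open>expectation_potential_le\<close>).
  Outside an event of probability at most \<open>x\<close> the completing normal variable has standard
  deviation at most \<open>\<beta> = k + 2 x s\<close>, so removing it costs \<open>O(\<beta> / s + x)\<close> and a
  fraction of \<open>\<delta>\<close> (\<open>smoothing\<close>). For \<open>k\<close> a large enough multiple of \<open>\<gamma>\<close> the terms with \<open>\<delta>\<close> on
  the right are absorbed on the left, which gives \<open>\<delta> = O(log s / s + x)\<close>
  (\<open>kolmogorov_distance_bound\<close>). Finally \<open>log s / s\<close> is dominated by \<open>x\<close>, because
  \<open>x \<ge> s\<^bsup>-2p/(2p+1)\<^esup>\<close>.

  That a constant for real sequences serves every sample space holds because all quantities in
  the bound depend only on the law of \<open>(X\<^sub>1, \<dots>, X\<^sub>n)\<close>, which lives on the space of real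
  sequences (\<open>rate_bound_transfer\<close>).
\<close>

section \<open>The normal distribution function and Taylor remainders\<close>

lemma taylor_second_order:
  fixes f :: "real \<Rightarrow> real"
  assumes "0 \<le> h"
    and "\<And>t. a \<le> t \<Longrightarrow> t \<le> a + h \<Longrightarrow> (f has_real_derivative f1 t) (at t)"
    and "\<And>t. a \<le> t \<Longrightarrow> t \<le> a + h \<Longrightarrow> (f1 has_real_derivative f2 t) (at t)"
    and "\<And>t. a \<le> t \<Longrightarrow> t \<le> a + h \<Longrightarrow> \<bar>f2 t\<bar> \<le> K"
  shows "\<bar>f (a + h) - f a - f1 a * h\<bar> \<le> K * h\<^sup>2 / 2"
proof (cases "h = 0")
  case False
  define diff where "diff = (\<lambda>m::nat. if m = 0 then f else if m = 1 then f1 else f2)"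
  have "\<exists>t. (if a + h < a then a + h < t \<and> t < a else a < t \<and> t < a + h) \<and>
      f (a + h) = (\<Sum>m<2. diff m a / fact m * (a + h - a) ^ m) + diff 2 t / fact 2 * (a + h - a) ^ 2"
    using assms(1-3) False
    by (intro Taylor[where a = a and b = "a + h"]) (auto simp: diff_def less_2_cases_iff)
  then obtain t where t: "a < t" "t < a + h"
    "f (a + h) = (\<Sum>m<2. diff m a / fact m * h ^ m) + diff 2 t / 2 * h ^ 2"
    using assms(1) by auto
  have "f (a + h) - f a - f1 a * h = f2 t * (h\<^sup>2 / 2)"
    using t(3) by (simp add: diff_def numeral_2_eq_2)
  moreover have "\<bar>f2 t\<bar> * (h\<^sup>2 / 2) \<le> K * (h\<^sup>2 / 2)"
    using assms(4)[of t] t by (intro mult_right_mono) auto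
  ultimately have "\<bar>f (a + h) - f a - f1 a * h\<bar> \<le> K * (h\<^sup>2 / 2)" by (simp only: abs_mult) simp
  then show ?thesis by simp
qed simp

lemma taylor_third_order:
  fixes f :: "real \<Rightarrow> real"
  assumes "\<And>t. (f has_real_derivative f1 t) (at t)"
    and "\<And>t. (f1 has_real_derivative f2 t) (at t)"
    and "\<And>t. (f2 has_real_derivative f3 t) (at t)"
    and "\<And>t. \<bar>t - a\<bar> \<le> \<bar>h\<bar> \<Longrightarrow> \<bar>f3 t\<bar> \<le> K"
  shows "\<bar>f (a + h) - f a - f1 a * h - f2 a * h\<^sup>2 / 2\<bar> \<le> K * \<bar>h\<bar>^3 / 6"
proof (cases "h = 0")
  case False
  define diff where "diff = (\<lambda>m::nat. if m = 0 then f else if m = 1 then f1 else if m = 2 then f2 else f3)"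
  have "\<exists>t. (if a + h < a then a + h < t \<and> t < a else a < t \<and> t < a + h) \<and>
      f (a + h) = (\<Sum>m<3. diff m a / fact m * (a + h - a) ^ m) + diff 3 t / fact 3 * (a + h - a) ^ 3"
    using assms(1-3) False
    by (intro Taylor[where a = "a - \<bar>h\<bar>" and b = "a + \<bar>h\<bar>"]) (auto simp: diff_def numeral_3_eq_3 less_Suc_eq)
  then obtain t where t: "if a + h < a then a + h < t \<and> t < a else a < t \<and> t < a + h"
    "f (a + h) = (\<Sum>m<3. diff m a / fact m * h ^ m) + diff 3 t / 6 * h ^ 3"
    by (auto simp: fact_numeral)
  have "f (a + h) - f a - f1 a * h - f2 a * h\<^sup>2 / 2 = f3 t * (h^3 / 6)"
    using t(2) by (simp add: diff_def numeral_3_eq_3 numeral_2_eq_2)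
  moreover have "\<bar>f3 t\<bar> * (\<bar>h\<bar>^3 / 6) \<le> K * (\<bar>h\<bar>^3 / 6)"
    using assms(4)[of t] t(1) by (intro mult_right_mono) (auto split: if_splits)
  ultimately have "\<bar>f (a + h) - f a - f1 a * h - f2 a * h\<^sup>2 / 2\<bar> \<le> K * (\<bar>h\<bar>^3 / 6)"
    by (simp only: abs_mult) (simp add: power_abs)
  then show ?thesis by simp
qed simp

abbreviation Phi :: "real \<Rightarrow> real" where
  "Phi \<equiv> cdf std_normal_distribution"

interpretation std_normal: real_distribution std_normal_distribution
  by (rule real_dist_normal_dist)

lemma isCont_std_normal_density: "isCont std_normal_density x"
  by (auto simp: std_normal_density_def[abs_def] intro!: continuous_intros)

lemma Phi_diff_eq_integral:
  assumes "a < b" shows "Phi b - Phi a = integral {a..b} std_normal_density"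
proof -
  have c: "continuous_on {a..b} std_normal_density"
    by (intro continuous_at_imp_continuous_on ballI isCont_std_normal_density)
  have "Phi b - Phi a = measure std_normal_distribution {a<..b}"
    using assms by (rule std_normal.cdf_diff_eq)
  also have "\<dots> = measure std_normal_distribution {a..b}"
  proof -
    have "AE x in lborel. x \<noteq> a" by (rule AE_lborel_singleton)
    then have "AE x in std_normal_distribution. (x \<in> {a<..b}) = (x \<in> {a..b})"
      using assms by (subst AE_density) (auto elim!: eventually_mono)
    then show ?thesis by (intro std_normal.finite_measure_eq_AE) auto
  qed
  also have "\<dots> = (\<integral>x. indicator {a..b} x \<partial>std_normal_distribution)" by simp
  also have "\<dots> = (\<integral>x. std_normal_density x * indicator {a..b} x \<partial>lborel)"
    by (subst integral_density) auto
  also have "\<dots> = set_lebesgue_integral lborel {a..b} std_normal_density"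
    by (simp add: set_lebesgue_integral_def mult.commute)
  also have "\<dots> = integral {a..b} std_normal_density"
    using borel_integrable_atLeastAtMost'[OF c] by (rule set_borel_integral_eq_integral)
  finally show ?thesis .
qed

lemma Phi_deriv: "(Phi has_real_derivative std_normal_density x) (at x)"
proof -
  have c: "continuous_on {x-1..x+1} std_normal_density"
    by (intro continuous_at_imp_continuous_on ballI isCont_std_normal_density)
  have "((\<lambda>u. integral {x-1..u} std_normal_density) has_real_derivative std_normal_density x) (at x within {x-1..x+1})"
    using c by (intro integral_has_real_derivative) auto
  then have "((\<lambda>u. integral {x-1..u} std_normal_density) has_real_derivative std_normal_density x) (at x)"
    by (simp add: at_within_Icc_at)
  then have d: "((\<lambda>u. integral {x-1..u} std_normal_density + Phi (x-1)) has_real_derivative std_normal_density x) (at x)"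
    by (auto intro!: derivative_eq_intros)
  have "eventually (\<lambda>u. u \<in> {x-1<..<x+1}) (nhds x)"
    by (rule eventually_nhds_in_open) auto
  then have "eventually (\<lambda>u. integral {x-1..u} std_normal_density + Phi (x-1) = Phi u) (nhds x)"
    by eventually_elim (use Phi_diff_eq_integral in force)
  then show ?thesis using d by (subst (asm) DERIV_cong_ev[OF refl _ refl]) auto
qed

lemma std_normal_density_le_exp: "std_normal_density x \<le> exp (- x\<^sup>2 / 2)"
proof -
  have "1 \<le> sqrt (2 * pi)" using pi_gt3 by simp
  then have "exp (- x\<^sup>2 / 2) * 1 \<le> exp (- x\<^sup>2 / 2) * sqrt (2 * pi)" by (intro mult_left_mono) auto
  then show ?thesis by (simp add: std_normal_density_def divide_le_eq)
qed

lemma std_normal_density_le_1: "std_normal_density x \<le> 1"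
  by (rule order_trans[OF std_normal_density_le_exp]) simp

text \<open>
  The density decays faster than any power of \<open>1 + y\<^sup>2\<close>; the fourth power suffices to absorb
  the polynomial factors in all derivatives of \<open>heat\<close> that occur below. The proof reads off
  \<open>e\<^bsup>y\<^sup>2/2\<^esup> = (e\<^bsup>y\<^sup>2/8\<^esup>)\<^sup>4 \<ge> (1 + y\<^sup>2/8)\<^sup>4\<close>.
\<close>

lemma std_normal_density_decay: "std_normal_density y * (1 + y\<^sup>2)^4 \<le> 4096"
proof -
  have "(1 + y\<^sup>2)^4 \<le> (8 * (1 + y\<^sup>2 / 8))^4" by (intro power_mono) auto
  also have "\<dots> = 4096 * (1 + y\<^sup>2/8)^4" by (simp only: power_mult_distrib) simp
  also have "\<dots> \<le> 4096 * exp (y\<^sup>2/8)^4"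
    by (intro mult_left_mono power_mono exp_ge_add_one_self) auto
  also have "exp (y\<^sup>2/8)^4 = exp (y\<^sup>2/2)" by (simp flip: exp_of_nat_mult)
  finally have "(1 + y\<^sup>2)^4 \<le> 4096 * exp (y\<^sup>2/2)" .
  then have "std_normal_density y * (1 + y\<^sup>2)^4 \<le> exp (- y\<^sup>2 / 2) * (4096 * exp (y\<^sup>2/2))"
    using std_normal_density_le_exp by (intro mult_mono) auto
  also have "\<dots> = 4096 * exp (- y\<^sup>2 / 2 + y\<^sup>2 / 2)" by (simp only: exp_add mult_ac)
  finally show ?thesis by simp
qed

lemma Phi_lipschitz: "\<bar>Phi x - Phi y\<bar> \<le> \<bar>x - y\<bar>"
proof -
  have *: "\<bar>Phi b - Phi a\<bar> \<le> \<bar>b - a\<bar>" if "a < b" for a b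
    using MVT2[OF that, of Phi std_normal_density] Phi_deriv std_normal_density_le_1 that
    by (auto simp: abs_mult mult_le_cancel_left1)
  show ?thesis using *[of x y] *[of y x] by (cases x y rule: linorder_cases) auto
qed

text \<open>
  An exponential tail is all that the smoothing argument needs. It holds because
  \<open>\<Phi>(u) + e\<^sup>-\<^sup>u\<close> decreases to its limit 1, the density being at most \<open>e\<^sup>-\<^sup>u\<close>.
\<close>

lemma Phi_tail: "1 - Phi y \<le> exp (- y)"
proof -
  have mono: "Phi u + exp (- u) \<le> Phi y + exp (- y)" if "y \<le> u" for u
  proof (rule DERIV_nonpos_imp_nonincreasing[OF that])
    fix x
    have s: "exp (1/2) \<le> sqrt (2 * pi)"
    proof (rule real_le_rsqrt)
      have "exp (1/2) ^ 2 = exp (1::real)" by (simp flip: exp_of_nat_mult)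
      also have "\<dots> \<le> 3" using exp_le by simp
      finally show "exp (1/2) ^ 2 \<le> 2 * pi" using pi_gt3 by simp
    qed
    have "std_normal_density x \<le> exp (- x)"
    proof -
      \<comment> \<open>Completing the square.\<close>
      have "- x\<^sup>2 / 2 \<le> 1/2 - x" using zero_le_power2[of "x - 1"] by (simp add: power2_diff)
      then have "exp (- x\<^sup>2 / 2) \<le> exp (1/2) * exp (- x)" by (simp flip: exp_add)
      also have "\<dots> \<le> sqrt (2 * pi) * exp (- x)" using s by simp
      finally show ?thesis by (simp add: std_normal_density_def field_simps)
    qed
    then show "\<exists>d. ((\<lambda>x. Phi x + exp (- x)) has_real_derivative d) (at x) \<and> d \<le> 0"
      by (intro exI[of _ "std_normal_density x - exp (- x)"])
        (auto intro!: derivative_eq_intros Phi_deriv)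
  qed
  have "((\<lambda>u. Phi u + exp (- u)) \<longlongrightarrow> 1 + 0) at_top"
    using std_normal.cdf_lim_at_top_prob exp_at_bot filterlim_uminus_at_bot_at_top
    by (intro tendsto_add) (auto intro: filterlim_compose)
  moreover have "eventually (\<lambda>u. Phi u + exp (- u) \<le> Phi y + exp (- y)) at_top"
    using eventually_ge_at_top[of y] by eventually_elim (rule mono)
  ultimately have "1 + 0 \<le> Phi y + exp (- y)"
    by (rule tendsto_upperbound) simp
  then show ?thesis by simp
qed

lemma Phi_uminus: "Phi (- x) = 1 - Phi x"
proof -
  have d: "((\<lambda>x. Phi x + Phi (- x)) has_real_derivative 0) (at x)" for x
    using DERIV_add[OF Phi_deriv DERIV_chain2[OF Phi_deriv DERIV_minus[OF DERIV_ident]]]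
    by (simp add: std_normal_density_def)
  then have const: "Phi x + Phi (- x) = Phi y + Phi (- y)" for x y
    using DERIV_isconst_all[of "\<lambda>x. Phi x + Phi (- x)"] by blast
  have "((\<lambda>u. Phi u + Phi (- u)) \<longlongrightarrow> 1 + 0) at_top"
    using std_normal.cdf_lim_at_top_prob std_normal.cdf_lim_at_bot filterlim_uminus_at_bot_at_top
    by (intro tendsto_add) (auto intro: filterlim_compose)
  then have "((\<lambda>u::real. Phi x + Phi (- x)) \<longlongrightarrow> 1) at_top"
    by (subst (asm) const[of _ x]) simp
  then show ?thesis by (simp add: tendsto_const_iff)
qed

text \<open>
  Rescaling the argument by \<open>c\<close> moves it by \<open>(c - 1) y\<close>, which is unbounded in \<open>y\<close>; the
  estimate is uniform because the derivative along the way is \<open>y\<close> times the density at \<open>z y\<close>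
  with \<open>z \<ge> 1\<close>, and this product is bounded.
\<close>

lemma Phi_scale:
  assumes "1 \<le> c" shows "\<bar>Phi (c * y) - Phi y\<bar> \<le> 4096 * (c - 1)"
proof (cases "c = 1 \<or> y = 0")
  case False
  have "1 < c" using False assms by auto
  have d: "((\<lambda>c. Phi (c * y)) has_real_derivative std_normal_density (z * y) * y) (at z)" for z
    by (rule derivative_eq_intros DERIV_chain2[OF Phi_deriv] | simp)+
  obtain z where z: "1 < z" "Phi (c * y) - Phi (1 * y) = (c - 1) * (std_normal_density (z * y) * y)"
    using MVT2[OF \<open>1 < c\<close>, of "\<lambda>c. Phi (c * y)" "\<lambda>z. std_normal_density (z * y) * y"] d by auto
  have "\<bar>std_normal_density (z * y) * y\<bar> \<le> std_normal_density (z * y) * (1 + (z*y)\<^sup>2)^4"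
  proof -
    have "\<bar>y\<bar> \<le> \<bar>z * y\<bar>" using z(1) by (simp add: abs_mult mult_le_cancel_right1)
    also have "\<dots> \<le> 1 + (z*y)\<^sup>2" using zero_le_power2[of "\<bar>z*y\<bar> - 1"] by (simp add: power2_diff)
    also have "\<dots> \<le> (1 + (z*y)\<^sup>2)^4" by (rule self_le_power) auto
    finally show ?thesis by (simp add: abs_mult mult_left_mono)
  qed
  then have "\<bar>std_normal_density (z * y) * y\<bar> \<le> 4096" using std_normal_density_decay[of "z*y"] by linarith
  then have "(c - 1) * \<bar>std_normal_density (z * y) * y\<bar> \<le> (c - 1) * 4096"
    using \<open>1 < c\<close> by (intro mult_left_mono) auto
  moreover have "\<bar>Phi (c * y) - Phi y\<bar> = (c - 1) * \<bar>std_normal_density (z * y) * y\<bar>"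
    using z(2) \<open>1 < c\<close> by (simp add: abs_mult)
  ultimately show ?thesis by simp
qed (use assms in auto)

section \<open>Two functions adapted to the backward heat equation\<close>

text \<open>
  \<open>heat r L\<close> is the probability that a centred normal variable of variance \<open>L\<close> is at most
  \<open>r\<close>. The suffixes \<open>r\<close> and \<open>L\<close> denote partial derivatives; the heat equation says that the
  derivative in \<open>L\<close> is \<open>heat_rr r L / 2\<close>, so \<open>heat_LL\<close> is the derivative of the latter.
\<close>

definition heat :: "real \<Rightarrow> real \<Rightarrow> real" where
  "heat r L = Phi (r / sqrt L)"
definition heat_r :: "real \<Rightarrow> real \<Rightarrow> real" where
  "heat_r r L = std_normal_density (r / sqrt L) / sqrt L"
definition heat_rr :: "real \<Rightarrow> real \<Rightarrow> real" where
  "heat_rr r L = - (std_normal_density (r / sqrt L) * r / sqrt L ^ 3)"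
definition heat_rrr :: "real \<Rightarrow> real \<Rightarrow> real" where
  "heat_rrr r L = std_normal_density (r / sqrt L) * ((r / sqrt L)\<^sup>2 - 1) / sqrt L ^ 3"
definition heat_LL :: "real \<Rightarrow> real \<Rightarrow> real" where
  "heat_LL r L = std_normal_density (r / sqrt L) * (3 * (r / sqrt L) - (r / sqrt L) ^ 3) / (4 * sqrt L ^ 4)"

lemma std_normal_density_deriv:
  "(std_normal_density has_real_derivative - (x * std_normal_density x)) (at x)"
  unfolding std_normal_density_def[abs_def] by (rule derivative_eq_intros | simp)+

lemma inverse_power_sqrt_deriv:
  assumes "0 < x"
  shows "((\<lambda>x. 1 / sqrt x ^ k) has_real_derivative - (real k / (2 * sqrt x ^ (k + 2)))) (at x)"
proof -
  define W where "W = sqrt x"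
  have W: "0 < W" using assms by (simp add: W_def)
  have "(sqrt has_real_derivative 1 / (2 * W)) (at x)"
    unfolding W_def using DERIV_real_sqrt[OF assms] by (simp add: field_simps)
  from DERIV_divide[OF DERIV_const DERIV_power[OF this, of k], of 1]
  have "((\<lambda>x. 1 / sqrt x ^ k) has_real_derivative
      (0 * W ^ k - 1 * (real k * (W ^ (k - 1) * (1 / (2 * W))))) / (W ^ k * W ^ k)) (at x)"
    using W by (simp add: W_def mult_ac)
  moreover have "(0 * W ^ k - 1 * (real k * (W ^ (k - 1) * (1 / (2 * W))))) / (W ^ k * W ^ k)
      = - (real k / (2 * W ^ (k + 2)))"
    using W by (cases k) (simp_all add: field_simps)
  ultimately show ?thesis by (simp add: W_def)
qed

lemma heat_deriv_r: "((\<lambda>r. heat r L) has_real_derivative heat_r r L) (at r)"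
  unfolding heat_def[abs_def] heat_r_def
  by (rule DERIV_cong[OF DERIV_chain2[OF Phi_deriv DERIV_cdivide[OF DERIV_ident]]]) simp

lemma heat_r_deriv_r: "((\<lambda>r. heat_r r L) has_real_derivative heat_rr r L) (at r)"
  unfolding heat_r_def[abs_def] heat_rr_def
  by (rule DERIV_cong[OF DERIV_cdivide[OF DERIV_chain2[OF std_normal_density_deriv DERIV_cdivide[OF DERIV_ident]]]])
    (simp add: power3_eq_cube)

lemma heat_rr_deriv_r: "((\<lambda>r. heat_rr r L) has_real_derivative heat_rrr r L) (at r)"
  unfolding heat_rr_def[abs_def] heat_rrr_def
  by (rule DERIV_cong[OF DERIV_minus[OF DERIV_cdivide[OF DERIV_mult[OF DERIV_chain2[OF
        std_normal_density_deriv DERIV_cdivide[OF DERIV_ident]] DERIV_ident]]]])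
    (simp add: power2_eq_square divide_simps, simp add: algebra_simps)

lemma divide_sqrt_deriv:
  assumes "0 < L"
  shows "((\<lambda>L. r / sqrt L ^ k) has_real_derivative - (r * real k / (2 * sqrt L ^ (k + 2)))) (at L)"
  using DERIV_cmult[OF inverse_power_sqrt_deriv[OF assms], of r k] by simp

lemma heat_deriv_L:
  assumes "0 < L" shows "((\<lambda>L. heat r L) has_real_derivative heat_rr r L / 2) (at L)"
  unfolding heat_def[abs_def] heat_rr_def
  by (rule DERIV_cong[OF DERIV_chain2[OF Phi_deriv divide_sqrt_deriv[OF assms, of r 1, simplified]]]) (simp add: power3_eq_cube)

lemma heat_rr_deriv_L:
  assumes "0 < L" shows "((\<lambda>L. heat_rr r L / 2) has_real_derivative heat_LL r L) (at L)"
proof -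
  define l where "l = sqrt L"
  have l: "0 < l" using assms by (simp add: l_def)
  have d1: "((\<lambda>L. r / sqrt L) has_real_derivative - (r / (2 * l ^ 3))) (at L)"
    using divide_sqrt_deriv[OF assms, of r 1] by (simp add: l_def power3_eq_cube mult_ac)
  have d3: "((\<lambda>L. r / sqrt L ^ 3) has_real_derivative - (r * 3 / (2 * l ^ 5))) (at L)"
    using divide_sqrt_deriv[OF assms, of r 3] by (simp add: l_def)
  have "((\<lambda>L. - (std_normal_density (r / sqrt L) * (r / sqrt L ^ 3)) / 2) has_real_derivative heat_LL r L) (at L)"
    by (rule DERIV_cong[OF DERIV_cdivide[OF DERIV_minus[OF DERIV_mult[OF DERIV_chain2[OF
          std_normal_density_deriv d1] d3]]]], unfold heat_LL_def l_def[symmetric])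
      (use l in \<open>simp add: power_divide divide_simps, simp add: algebra_simps eval_nat_numeral\<close>)
  then show ?thesis unfolding heat_rr_def by simp
qed

text \<open>
  With \<open>y = r / \<surd>L\<close>, both derivatives are a power of \<open>1 / \<surd>L\<close> times a polynomial in \<open>y\<close>
  times the density at \<open>y\<close>. The decay of the density turns each factor \<open>1 / \<surd>L\<close> into the
  smaller \<open>1 / (\<surd>L m)\<close> with \<open>m = \<surd>(1 + y\<^sup>2)\<close>, and \<open>\<surd>L m = \<surd>(L + r\<^sup>2)\<close> is
  comparable with \<open>\<surd>(2 L + r\<^sup>2)\<close>.
\<close>

lemma heat_derivative_bounds:
  assumes "0 < L"
  shows "\<bar>heat_rrr r L\<bar> \<le> 32768 / sqrt (2 * L + r\<^sup>2) ^ 3"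
    and "\<bar>heat_LL r L\<bar> \<le> 65536 / sqrt (2 * L + r\<^sup>2) ^ 4"
proof -
  define l y W m where "l = sqrt L" and "y = r / l" and "W = sqrt (2 * L + r\<^sup>2)"
    and "m = sqrt (1 + y\<^sup>2)"
  have l: "0 < l" "l\<^sup>2 = L" using assms by (simp_all add: l_def)
  have m: "1 \<le> m" "m\<^sup>2 = 1 + y\<^sup>2" by (simp_all add: m_def)
  have W: "0 < W" using assms by (simp add: W_def add_pos_nonneg)
  have r: "r = y * l" using l by (simp add: y_def)
  have "W\<^sup>2 = 2 * L + r\<^sup>2" using assms by (simp add: W_def)
  also have "\<dots> = 2 * l\<^sup>2 + y\<^sup>2 * l\<^sup>2" by (simp only: l(2) r power_mult_distrib)
  also have "\<dots> \<le> 4 * l\<^sup>2 + 4 * (y\<^sup>2 * l\<^sup>2)" by simp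
  also have "\<dots> = 4 * (l\<^sup>2 * (1 + y\<^sup>2))" by algebra
  also have "\<dots> = (2 * (l * m))\<^sup>2" by (simp only: power_mult_distrib m(2) mult.assoc) simp
  finally have "W\<^sup>2 \<le> (2 * (l * m))\<^sup>2" .
  then have Wl: "W \<le> 2 * (l * m)" by (rule power2_le_imp_le) (use l(1) m(1) in simp)
  have y: "\<bar>y\<bar> \<le> m" by (rule power2_le_imp_le) (use m in auto)
  have dens: "std_normal_density y \<le> 4096 / m ^ 8"
  proof -
    have "m ^ 8 = (1 + y\<^sup>2)^4" by (simp flip: m(2) power_mult)
    then have "std_normal_density y * m ^ 8 \<le> 4096" using std_normal_density_decay[of y] by simp
    moreover have "0 < m ^ 8" using m(1) by (intro zero_less_power) simp
    ultimately show ?thesis by (simp only: pos_le_divide_eq)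
  qed
  have key: "std_normal_density y * c / l ^ k \<le> 4096 * 2 ^ k / W ^ k" if "c \<le> m ^ 3" "k \<le> 5" for c and k :: nat
  proof -
    have "std_normal_density y * c \<le> 4096 / m ^ 8 * m ^ 3"
    proof (cases "0 \<le> c")
      case True then show ?thesis using dens that m(1) by (intro mult_mono) auto
    next
      case False
      then have "std_normal_density y * c \<le> 0" by (simp add: mult_nonneg_nonpos)
      also have "\<dots> \<le> 4096 / m ^ 8 * m ^ 3" using m(1) by simp
      finally show ?thesis .
    qed
    also have "\<dots> = 4096 / m ^ 5" using m(1) by (simp add: field_simps flip: power_add)
    also have "\<dots> \<le> 4096 / m ^ k" using m(1) that by (intro divide_left_mono power_increasing) auto
    finally have "std_normal_density y * c / l ^ k \<le> 4096 / m ^ k / l ^ k"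
      using l(1) by (intro divide_right_mono) auto
    also have "\<dots> = 4096 * 2 ^ k / (2 * (l * m)) ^ k" by (simp add: power_mult_distrib)
    also have "\<dots> \<le> 4096 * 2 ^ k / W ^ k"
      using W Wl by (intro divide_left_mono power_mono) auto
    finally show ?thesis .
  qed
  have "\<bar>y\<^sup>2 - 1\<bar> \<le> m\<^sup>2" unfolding m(2) using zero_le_power2[of y] by linarith
  also have "\<dots> \<le> m ^ 3" using m(1) by (intro power_increasing) auto
  finally have "std_normal_density y * \<bar>y\<^sup>2 - 1\<bar> / l ^ 3 \<le> 4096 * 2 ^ 3 / W ^ 3" by (rule key) simp
  then show "\<bar>heat_rrr r L\<bar> \<le> 32768 / sqrt (2 * L + r\<^sup>2) ^ 3"
    using l(1) by (simp add: heat_rrr_def abs_mult flip: l_def y_def W_def)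
  have "\<bar>3 * y - y ^ 3\<bar> \<le> 3 * \<bar>y\<bar> + \<bar>y\<bar> ^ 3" by (simp add: power_abs[symmetric] abs_mult abs_triangle_ineq4[THEN order_trans])
  also have "\<dots> \<le> 3 * m ^ 3 + m ^ 3"
  proof (intro add_mono mult_left_mono power_mono y)
    show "\<bar>y\<bar> \<le> m ^ 3" using y self_le_power[OF m(1), of 3] by simp
  qed auto
  finally have "\<bar>3 * y - y ^ 3\<bar> / 4 \<le> m ^ 3" by simp
  then have "std_normal_density y * (\<bar>3 * y - y ^ 3\<bar> / 4) / l ^ 4 \<le> 4096 * 2 ^ 4 / W ^ 4" by (rule key) simp
  then show "\<bar>heat_LL r L\<bar> \<le> 65536 / sqrt (2 * L + r\<^sup>2) ^ 4"
    using l(1) by (simp add: heat_LL_def abs_mult flip: l_def y_def W_def)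
qed

text \<open>
  Writing \<open>W\<^sup>2 = 2 L + r\<^sup>2\<close>, the function \<open>1 / W\<close> satisfies
  \<open>potential_rr r L / 2 - \<partial>/\<partial>L potential r L = W\<^sup>-\<^sup>3 / 2 + 3 r\<^sup>2 W\<^sup>-\<^sup>5 / 2\<close>.
  So it is a strict subsolution of the backward heat equation, with a gain \<open>W\<^sup>-\<^sup>3 / 2\<close> of
  the same form as the bound on the third derivative of \<open>heat\<close>. Any factor larger than 1 in
  place of 2 in front of \<open>L\<close> would do, whereas with the factor 1 the gain vanishes at
  \<open>r = 0\<close>.
\<close>

definition potential :: "real \<Rightarrow> real \<Rightarrow> real" where
  "potential r L = 1 / sqrt (2 * L + r\<^sup>2)"
definition potential_r :: "real \<Rightarrow> real \<Rightarrow> real" where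
  "potential_r r L = - (r / sqrt (2 * L + r\<^sup>2) ^ 3)"
definition potential_rr :: "real \<Rightarrow> real \<Rightarrow> real" where
  "potential_rr r L = 3 * r\<^sup>2 / sqrt (2 * L + r\<^sup>2) ^ 5 - 1 / sqrt (2 * L + r\<^sup>2) ^ 3"

lemma inverse_power_shifted_sqrt_deriv:
  assumes "0 < L"
  shows "((\<lambda>r. 1 / sqrt (2 * L + r\<^sup>2) ^ k) has_real_derivative
      - (real k * r / sqrt (2 * L + r\<^sup>2) ^ (k + 2))) (at r)"
    and "((\<lambda>L. 1 / sqrt (2 * L + r\<^sup>2) ^ k) has_real_derivative
      - (real k / sqrt (2 * L + r\<^sup>2) ^ (k + 2))) (at L)"
proof -
  have pos: "0 < 2 * L + r\<^sup>2" using assms by (simp add: add_pos_nonneg)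
  have dr: "((\<lambda>r. 2 * L + r\<^sup>2) has_real_derivative 2 * r) (at r)"
    and dL: "((\<lambda>L. 2 * L + r\<^sup>2) has_real_derivative 2) (at L)"
    by (auto intro!: derivative_eq_intros)
  show "((\<lambda>r. 1 / sqrt (2 * L + r\<^sup>2) ^ k) has_real_derivative
      - (real k * r / sqrt (2 * L + r\<^sup>2) ^ (k + 2))) (at r)"
    by (rule DERIV_cong[OF DERIV_chain2[OF inverse_power_sqrt_deriv[OF pos] dr]]) simp
  show "((\<lambda>L. 1 / sqrt (2 * L + r\<^sup>2) ^ k) has_real_derivative
      - (real k / sqrt (2 * L + r\<^sup>2) ^ (k + 2))) (at L)"
    by (rule DERIV_cong[OF DERIV_chain2[OF inverse_power_sqrt_deriv[OF pos] dL]]) simp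
qed

lemma divide_power_antimono:
  fixes c x y :: real
  assumes "0 < x" "x \<le> y" "0 \<le> c" shows "c / y ^ k \<le> c / x ^ k"
  using assms by (intro divide_left_mono power_mono mult_pos_pos zero_less_power) auto

text \<open>
  A martingale step moves \<open>r\<close> by at most \<open>\<gamma> \<le> \<surd>L\<close>, and this changes \<open>W\<close> at most by a factor
  of 2. Hence remainder terms evaluated at intermediate points can be compared with the value
  of \<open>W\<close> before the step.
\<close>

lemma sqrt_shift_le:
  assumes "\<gamma>\<^sup>2 \<le> L" "\<bar>h\<bar> \<le> \<gamma>"
  shows "sqrt (2 * L + r\<^sup>2) \<le> 2 * sqrt (2 * L + (r + h)\<^sup>2)"
proof -
  have "h\<^sup>2 \<le> L" using assms power_mono[OF assms(2), of 2] by simp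
  moreover have "r\<^sup>2 \<le> 2 * (r + h)\<^sup>2 + 2 * h\<^sup>2"
    using zero_le_power2[of "r + 2 * h"] by (simp add: power2_eq_square algebra_simps)
  ultimately have "2 * L + r\<^sup>2 \<le> 4 * (2 * L + (r + h)\<^sup>2)"
    using zero_le_power2[of "r + h"] zero_le_power2[of h] zero_le_power2[of \<gamma>] assms(1)
    by (smt (verit))
  then have "sqrt (2 * L + r\<^sup>2) \<le> sqrt (4 * (2 * L + (r + h)\<^sup>2))" by (rule real_sqrt_le_mono)
  then show ?thesis by (simp only: real_sqrt_mult real_sqrt_four)
qed

text \<open>
  In a step the space variable changes from \<open>r\<close> to \<open>r - y\<close> and the remaining variance from
  \<open>L + v\<close> to \<open>L\<close>. By the heat equation the second-order term in \<open>y\<close> and the first-order term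
  in \<open>v\<close> combine to a multiple of \<open>y\<^sup>2 - v\<close>, which has conditional expectation zero if \<open>v\<close>
  is the conditional variance of \<open>y\<close>.
\<close>

lemma heat_expansion:
  assumes "0 < \<gamma>" "\<gamma>\<^sup>2 \<le> L" "\<bar>y\<bar> \<le> \<gamma>" "0 \<le> v" "v \<le> \<gamma>\<^sup>2"
  shows "\<bar>heat (r - y) L - heat r (L + v) + heat_r r L * y - heat_rr r L * (y\<^sup>2 - v) / 2\<bar>
    \<le> 65536 * \<gamma> * (y\<^sup>2 + v) / sqrt (2 * L + r\<^sup>2) ^ 3"
proof -
  define W where "W = sqrt (2 * L + r\<^sup>2)"
  have L: "0 < L" using assms(1,2) zero_less_power[of \<gamma> 2] by linarith
  then have W: "0 < W" by (simp add: W_def add_pos_nonneg)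
  have gW: "\<gamma> \<le> W" unfolding W_def using assms(2) L by (intro real_le_rsqrt) (simp add: add_increasing2)
  have "\<bar>heat_rrr t L\<bar> \<le> 32768 * 8 / W ^ 3" if "\<bar>t - r\<bar> \<le> \<bar>- y\<bar>" for t
  proof -
    have "W \<le> 2 * sqrt (2 * L + t\<^sup>2)"
      using sqrt_shift_le[OF assms(2), of "t - r" r] that assms(3) by (simp add: W_def)
    then have "W ^ 3 \<le> (2 * sqrt (2 * L + t\<^sup>2)) ^ 3" using W by (intro power_mono) auto
    then have W3: "W ^ 3 \<le> 8 * sqrt (2 * L + t\<^sup>2) ^ 3" by (simp only: power_mult_distrib) simp
    have "\<bar>heat_rrr t L\<bar> \<le> 32768 / sqrt (2 * L + t\<^sup>2) ^ 3" by (rule heat_derivative_bounds[OF L])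
    also have "\<dots> = 32768 * 8 / (8 * sqrt (2 * L + t\<^sup>2) ^ 3)" by simp
    also have "\<dots> \<le> 32768 * 8 / W ^ 3"
      using W3 W L by (intro divide_left_mono mult_pos_pos) (auto simp: add_pos_nonneg)
    finally show ?thesis .
  qed
  from taylor_third_order[where a = r and h = "- y", OF heat_deriv_r heat_r_deriv_r heat_rr_deriv_r this]
  have A: "\<bar>heat (r - y) L - heat r L + heat_r r L * y - heat_rr r L * y\<^sup>2 / 2\<bar>
      \<le> 32768 * 8 / W ^ 3 * \<bar>y\<bar> ^ 3 / 6" by simp
  have "32768 * 8 / W ^ 3 * \<bar>y\<bar> ^ 3 / 6 \<le> 65536 / W ^ 3 * \<bar>y\<bar> ^ 3"
    using W by (simp add: field_simps)
  also have "\<dots> \<le> 65536 / W ^ 3 * (\<gamma> * y\<^sup>2)"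
    using W mult_right_mono[OF assms(3), of "y\<^sup>2"]
    by (intro mult_left_mono) (auto simp: power3_eq_cube power2_eq_square mult_ac)
  finally have A': "32768 * 8 / W ^ 3 * \<bar>y\<bar> ^ 3 / 6 \<le> 65536 * \<gamma> * y\<^sup>2 / W ^ 3" by simp
  have "\<bar>heat_LL r t\<bar> \<le> 65536 / W ^ 4" if "L \<le> t" for t
  proof -
    have "\<bar>heat_LL r t\<bar> \<le> 65536 / sqrt (2 * t + r\<^sup>2) ^ 4" using L that by (intro heat_derivative_bounds) auto
    also have "\<dots> \<le> 65536 / W ^ 4"
    proof -
      have "W \<le> sqrt (2 * t + r\<^sup>2)" using that by (simp add: W_def)
      then show ?thesis using W by (intro divide_power_antimono) auto
    qed
    finally show ?thesis .
  qed
  from taylor_second_order[OF assms(4) heat_deriv_L heat_rr_deriv_L this, of L] L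
  have "\<bar>heat r (L + v) - heat r L - heat_rr r L / 2 * v\<bar> \<le> 65536 / W ^ 4 * v\<^sup>2 / 2" by auto
  also have "\<dots> \<le> 65536 * \<gamma> * v / W ^ 3"
  proof -
    have "v * v \<le> \<gamma> * W * v"
      using assms gW by (intro mult_right_mono) (auto simp: power2_eq_square intro: order_trans[OF _ mult_left_mono])
    then have "32768 * (v * v) \<le> 65536 * (\<gamma> * W * v)" using assms(4) zero_le_square[of v] by linarith
    then have "65536 / W ^ 4 * v\<^sup>2 / 2 \<le> 65536 / W ^ 4 * (\<gamma> * W * v)"
      using W by (simp add: power2_eq_square divide_right_mono)
    also have "\<dots> = 65536 * \<gamma> * v / W ^ 3" using W by (simp add: eval_nat_numeral)
    finally show ?thesis .
  qed
  finally have B: "\<bar>heat r (L + v) - heat r L - heat_rr r L / 2 * v\<bar> \<le> 65536 * \<gamma> * v / W ^ 3" .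
  have "65536 * \<gamma> * (y\<^sup>2 + v) / W ^ 3 = 65536 * \<gamma> * y\<^sup>2 / W ^ 3 + 65536 * \<gamma> * v / W ^ 3"
    by (simp add: distrib_left add_divide_distrib)
  moreover have "heat_rr r L * (y\<^sup>2 - v) / 2 = heat_rr r L * y\<^sup>2 / 2 - heat_rr r L / 2 * v"
    by (simp add: algebra_simps diff_divide_distrib)
  ultimately show ?thesis unfolding W_def[symmetric] using A A' B by linarith
qed

text \<open>
  The same expansion for \<open>potential\<close>. Here the first-order terms leave the gain
  \<open>v / (2 W\<^sup>3)\<close>. The Taylor remainders carry an additional factor \<open>\<gamma> / W\<close>, and requiring
  \<open>W \<ge> 512 \<gamma>\<close> makes them a small fraction of the gain: with \<open>y\<^sup>2\<close> replaced by its
  conditional expectation \<open>v\<close>, half of the gain remains.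
\<close>

lemma potential_expansion:
  assumes "0 < \<gamma>" "(512 * \<gamma>)\<^sup>2 \<le> L" "\<bar>y\<bar> \<le> \<gamma>" "0 \<le> v" "v \<le> \<gamma>\<^sup>2"
  shows "potential (r - y) L - potential r (L + v) + potential_r r L * y - potential_rr r L * (y\<^sup>2 - v) / 2
    \<ge> v / (2 * sqrt (2 * L + r\<^sup>2) ^ 3) - (y\<^sup>2 + v) / (8 * sqrt (2 * L + r\<^sup>2) ^ 3)"
proof -
  define W where "W = sqrt (2 * L + r\<^sup>2)"
  have "262144 * \<gamma>\<^sup>2 \<le> L" using assms(2) by (simp add: power_mult_distrib)
  then have gL: "\<gamma>\<^sup>2 \<le> L" using zero_le_power2[of \<gamma>] by linarith
  have L: "0 < L" using assms(1) gL zero_less_power[of \<gamma> 2] by linarith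
  then have W: "0 < W" by (simp add: W_def add_pos_nonneg)
  have gW: "512 * \<gamma> \<le> W" unfolding W_def using assms(2) L by (intro real_le_rsqrt) (simp add: add_increasing2)
  define k3 where "k3 t = 9 * t / sqrt (2 * L + t\<^sup>2) ^ 5 - 15 * t ^ 3 / sqrt (2 * L + t\<^sup>2) ^ 7" for t
  have d1: "((\<lambda>r. potential r L) has_real_derivative potential_r t L) (at t)" for t
    unfolding potential_def[abs_def] potential_r_def
    using inverse_power_shifted_sqrt_deriv(1)[OF L, where r = t and k = 1] by (simp add: power3_eq_cube mult_ac)
  have d2: "((\<lambda>r. potential_r r L) has_real_derivative potential_rr t L) (at t)" for t
  proof -
    have "0 < sqrt (2 * L + t\<^sup>2)" using L by (simp add: add_pos_nonneg)
    then show ?thesis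
      unfolding potential_r_def[abs_def] potential_rr_def
      using DERIV_minus[OF DERIV_mult[OF DERIV_ident inverse_power_shifted_sqrt_deriv(1)[OF L, where r = t and k = 3]]]
      by (simp add: power2_eq_square mult.assoc)
  qed
  have d3: "((\<lambda>r. potential_rr r L) has_real_derivative k3 t) (at t)" for t
  proof -
    have e: "((\<lambda>r. 3 * r\<^sup>2) has_real_derivative 6 * t) (at t)" by (auto intro!: derivative_eq_intros)
    show ?thesis
      unfolding potential_rr_def[abs_def] k3_def
      using DERIV_diff[OF DERIV_mult[OF e inverse_power_shifted_sqrt_deriv(1)[OF L, where r = t and k = 5]]
          inverse_power_shifted_sqrt_deriv(1)[OF L, where r = t and k = 3]]
      by (simp add: power2_eq_square power3_eq_cube mult.assoc)
  qed
  have "\<bar>k3 t\<bar> \<le> 24 * 16 / W ^ 4" if "\<bar>t - r\<bar> \<le> \<bar>- y\<bar>" for t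
  proof -
    define w where "w = sqrt (2 * L + t\<^sup>2)"
    have w: "0 < w" using L by (simp add: w_def add_pos_nonneg)
    have tw: "\<bar>t\<bar> \<le> w" unfolding w_def using L by (intro real_le_rsqrt) simp
    have "W \<le> 2 * w" using sqrt_shift_le[OF gL, of "t - r" r] that assms(3) by (simp add: W_def w_def)
    then have "W ^ 4 \<le> (2 * w) ^ 4" using W by (intro power_mono) auto
    then have W4: "W ^ 4 \<le> 16 * w ^ 4" by (simp only: power_mult_distrib) simp
    have "\<bar>k3 t\<bar> \<le> 9 * \<bar>t\<bar> / w ^ 5 + 15 * \<bar>t\<bar> ^ 3 / w ^ 7"
      unfolding k3_def w_def[symmetric] using w
      by (intro order_trans[OF abs_triangle_ineq4]) (simp add: abs_mult power_abs)
    also have "\<dots> \<le> 9 * w / w ^ 5 + 15 * w ^ 3 / w ^ 7"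
      using tw w by (intro add_mono divide_right_mono mult_left_mono power_mono) auto
    also have "\<dots> = 24 * 16 / (16 * w ^ 4)" using w by (simp add: eval_nat_numeral field_simps)
    also have "\<dots> \<le> 24 * 16 / W ^ 4" using W4 W w by (intro divide_left_mono) auto
    finally show ?thesis .
  qed
  from taylor_third_order[where a = r and h = "- y", OF d1 d2 d3 this]
  have A: "\<bar>potential (r - y) L - potential r L + potential_r r L * y - potential_rr r L * y\<^sup>2 / 2\<bar>
      \<le> 24 * 16 / W ^ 4 * \<bar>y\<bar> ^ 3 / 6" by simp
  have small: "64 * \<gamma> * c / W ^ 4 \<le> c / (8 * W ^ 3)" if "0 \<le> c" for c
  proof -
    have "64 * \<gamma> * c / W ^ 4 \<le> (W / 8) * c / W ^ 4"
      using gW that W by (intro divide_right_mono mult_right_mono) auto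
    also have "\<dots> = c / (8 * W ^ 3)" using W by (simp add: eval_nat_numeral)
    finally show ?thesis .
  qed
  have "24 * 16 / W ^ 4 * \<bar>y\<bar> ^ 3 / 6 \<le> 64 / W ^ 4 * (\<gamma> * y\<^sup>2)"
    using assms(3) W mult_right_mono[OF assms(3), of "y\<^sup>2"]
    by (simp add: power3_eq_cube power2_eq_square divide_right_mono mult_ac)
  with small[of "y\<^sup>2"] have A': "24 * 16 / W ^ 4 * \<bar>y\<bar> ^ 3 / 6 \<le> y\<^sup>2 / (8 * W ^ 3)" by simp
  have dL1: "((\<lambda>L. potential r L) has_real_derivative - (1 / sqrt (2 * t + r\<^sup>2) ^ 3)) (at t)" if "L \<le> t" for t
    unfolding potential_def[abs_def]
    using inverse_power_shifted_sqrt_deriv(2)[where L = t and r = r and k = 1] that L by (simp add: power3_eq_cube mult_ac)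
  have dL2: "((\<lambda>L. - (1 / sqrt (2 * L + r\<^sup>2) ^ 3)) has_real_derivative 3 / sqrt (2 * t + r\<^sup>2) ^ 5) (at t)"
    if "L \<le> t" for t
    using DERIV_minus[OF inverse_power_shifted_sqrt_deriv(2)[where L = t and r = r and k = 3]] that L by simp
  have "\<bar>3 / sqrt (2 * t + r\<^sup>2) ^ 5\<bar> \<le> 3 / W ^ 5" if "L \<le> t" for t
  proof -
    have "W \<le> sqrt (2 * t + r\<^sup>2)" using that by (simp add: W_def)
    then have "3 / sqrt (2 * t + r\<^sup>2) ^ 5 \<le> 3 / W ^ 5"
      using W by (intro divide_power_antimono) auto
    then show ?thesis using that L by (simp add: abs_of_nonneg)
  qed
  from taylor_second_order[OF assms(4) dL1 dL2 this, of L]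
  have "\<bar>potential r (L + v) - potential r L + v / W ^ 3\<bar> \<le> 3 / W ^ 5 * v\<^sup>2 / 2" by (simp add: W_def)
  also have "\<dots> \<le> 64 * \<gamma> * v / W ^ 4"
  proof -
    have "v \<le> \<gamma> * W" using assms gW
      by (intro order_trans[OF assms(5)]) (auto simp: power2_eq_square)
    then have "v * v \<le> \<gamma> * W * v" using assms(4) by (intro mult_right_mono) auto
    then have "3 * (v * v) \<le> 128 * (\<gamma> * W * v)" using assms(4) zero_le_square[of v] by linarith
    then have "3 / W ^ 5 * v\<^sup>2 / 2 \<le> 64 / W ^ 5 * (\<gamma> * W * v)"
      using W by (simp add: power2_eq_square divide_simps)
    also have "\<dots> = 64 * \<gamma> * v / W ^ 4" using W by (simp add: eval_nat_numeral)
    finally show ?thesis .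
  qed
  also have "\<dots> \<le> v / (8 * W ^ 3)" by (rule small[OF assms(4)])
  finally have B: "\<bar>potential r (L + v) - potential r L + v / W ^ 3\<bar> \<le> v / (8 * W ^ 3)" .
  have C: "- (v / (2 * W ^ 3)) \<le> potential_rr r L * v / 2"
  proof -
    have "- (1 / W ^ 3) \<le> potential_rr r L" using W by (simp add: potential_rr_def flip: W_def)
    from mult_right_mono[OF this assms(4)] show ?thesis by simp
  qed
  have "(y\<^sup>2 + v) / (8 * W ^ 3) = y\<^sup>2 / (8 * W ^ 3) + v / (8 * W ^ 3)" by (rule add_divide_distrib)
  moreover have "potential_rr r L * (y\<^sup>2 - v) / 2 = potential_rr r L * y\<^sup>2 / 2 - potential_rr r L * v / 2"
    by (simp add: algebra_simps diff_divide_distrib)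
  moreover have "v / W ^ 3 = v / (2 * W ^ 3) + v / (2 * W ^ 3)" by simp
  ultimately show ?thesis unfolding W_def[symmetric] using A A' B C by linarith
qed

section \<open>Replacing the increments of a bounded martingale by Gaussian ones\<close>

lemma borel_measurable_Phi [measurable]: "Phi \<in> borel_measurable borel"
  by (intro borel_measurable_continuous_onI continuous_at_imp_continuous_on ballI DERIV_isCont[OF Phi_deriv])

lemma measurable_heat_potential [measurable (raw)]:
  assumes [measurable]: "f \<in> borel_measurable M" "g \<in> borel_measurable M"
  shows "(\<lambda>\<omega>. heat (f \<omega>) (g \<omega>)) \<in> borel_measurable M"
    and "(\<lambda>\<omega>. heat_r (f \<omega>) (g \<omega>)) \<in> borel_measurable M"
    and "(\<lambda>\<omega>. heat_rr (f \<omega>) (g \<omega>)) \<in> borel_measurable M"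
    and "(\<lambda>\<omega>. potential (f \<omega>) (g \<omega>)) \<in> borel_measurable M"
    and "(\<lambda>\<omega>. potential_r (f \<omega>) (g \<omega>)) \<in> borel_measurable M"
    and "(\<lambda>\<omega>. potential_rr (f \<omega>) (g \<omega>)) \<in> borel_measurable M"
  unfolding heat_def heat_r_def heat_rr_def potential_def potential_r_def potential_rr_def
  by measurable

lemma heat_bounds: "0 \<le> heat r L" "heat r L \<le> 1" "\<bar>heat r L\<bar> \<le> 1"
  using std_normal.cdf_bounded_prob[of "r / sqrt L"] std_normal.cdf_nonneg[of "r / sqrt L"]
  by (auto simp: heat_def)

lemma heat_partials_bounded:
  assumes "0 < k" "k\<^sup>2 \<le> L"
  shows "\<bar>heat_r r L\<bar> \<le> 1 / k" "\<bar>heat_rr r L\<bar> \<le> 4096 / k\<^sup>2"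
proof -
  define l y where "l = sqrt L" and "y = r / l"
  have l: "k \<le> l" unfolding l_def using assms by (intro real_le_rsqrt)
  have "\<bar>heat_r r L\<bar> = std_normal_density y / l"
    using l assms(1) by (simp add: heat_r_def flip: l_def y_def)
  also have "\<dots> \<le> 1 / k"
    using l assms(1) std_normal_density_le_1 by (intro frac_le) auto
  finally show "\<bar>heat_r r L\<bar> \<le> 1 / k" .
  have "\<bar>y\<bar> \<le> 1 + y\<^sup>2" using zero_le_power2[of "\<bar>y\<bar> - 1"] by (simp add: power2_diff)
  also have "\<dots> \<le> (1 + y\<^sup>2)^4" by (rule self_le_power) auto
  finally have "std_normal_density y * \<bar>y\<bar> \<le> 4096"
    using std_normal_density_decay[of y] by (smt (verit) mult_left_mono normal_density_nonneg)
  moreover have "heat_rr r L = - (std_normal_density y * y / l\<^sup>2)"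
    using l assms(1) by (simp add: heat_rr_def y_def l_def power2_eq_square power3_eq_cube)
  ultimately show "\<bar>heat_rr r L\<bar> \<le> 4096 / k\<^sup>2"
    using l assms(1) by (auto simp: abs_mult intro!: frac_le power_mono)
qed

lemma potential_partials_bounded:
  assumes "0 < k" "k\<^sup>2 \<le> L"
  shows "0 \<le> potential r L" "potential r L \<le> 1 / k" "\<bar>potential_r r L\<bar> \<le> 1 / k\<^sup>2"
    "\<bar>potential_rr r L\<bar> \<le> 4 / k ^ 3" "k \<le> sqrt (2 * L + r\<^sup>2)"
proof -
  define W where "W = sqrt (2 * L + r\<^sup>2)"
  have L: "0 < L" using assms zero_less_power[of k 2] by linarith
  have kW: "k \<le> W" unfolding W_def using assms L by (intro real_le_rsqrt) (simp add: add_increasing2)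
  have W: "0 < W" using kW assms(1) by simp
  have rW: "\<bar>r\<bar> \<le> W" unfolding W_def using L by (intro real_le_rsqrt) simp
  show "k \<le> sqrt (2 * L + r\<^sup>2)" using kW by (simp add: W_def)
  show "0 \<le> potential r L" using L by (simp add: potential_def)
  show "potential r L \<le> 1 / k"
    using kW assms(1) by (simp add: potential_def frac_le flip: W_def)
  have "\<bar>potential_r r L\<bar> \<le> W / W ^ 3"
    using rW W by (simp add: potential_r_def abs_mult divide_right_mono flip: W_def)
  also have "\<dots> = 1 / W\<^sup>2" using W by (simp add: eval_nat_numeral)
  also have "\<dots> \<le> 1 / k\<^sup>2" using kW assms(1) by (intro divide_power_antimono) auto
  finally show "\<bar>potential_r r L\<bar> \<le> 1 / k\<^sup>2" .
  have "\<bar>potential_rr r L\<bar> \<le> 3 * r\<^sup>2 / W ^ 5 + 1 / W ^ 3"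
    unfolding potential_rr_def W_def[symmetric] using W
    by (intro order_trans[OF abs_triangle_ineq4]) simp
  also have "3 * r\<^sup>2 / W ^ 5 \<le> 3 * W\<^sup>2 / W ^ 5"
    using rW W power_mono[OF rW, of 2] by (intro divide_right_mono) auto
  also have "3 * W\<^sup>2 / W ^ 5 + 1 / W ^ 3 = 4 / W ^ 3" using W by (simp add: eval_nat_numeral field_simps)
  also have "\<dots> \<le> 4 / k ^ 3" using kW assms(1) by (intro divide_power_antimono) auto
  finally show "\<bar>potential_rr r L\<bar> \<le> 4 / k ^ 3" by simp
qed

lemma (in prob_space) integrable_bounded:
  fixes f :: "'a \<Rightarrow> real"
  assumes "f \<in> borel_measurable M" "\<And>\<omega>. \<omega> \<in> space M \<Longrightarrow> \<bar>f \<omega>\<bar> \<le> C"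
  shows "integrable M f"
  using assms by (intro integrable_const_bound[of _ C]) auto

text \<open>
  One exchange step. Here \<open>F\<close> is the past, \<open>U\<close> is \<open>t\<close> minus the sum before the step \<open>Y\<close>, \<open>v\<close>
  is the conditional variance of \<open>Y\<close>, and \<open>L\<close> is the variance that remains after the step. It
  is essential that \<open>L\<close> is measurable with respect to the past: then the coefficients of \<open>Y\<close>
  and \<open>Y\<^sup>2 - v\<close> in the two expansions are \<open>F\<close>-measurable and these terms have expectation
  zero. What remains are multiples of \<open>m\<close>, the expectation of \<open>v / W\<^sup>3\<close>: the error for
  \<open>heat\<close> is at most \<open>131072 \<gamma> m\<close>, and the gain of \<open>potential\<close> is at least \<open>m / 4\<close>.

  The conditional moments enter only through the two identities for bounded \<open>F\<close>-measurable
  factors, so versions of \<open>Y\<close> and \<open>v\<close> that are bounded everywhere may be used.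
\<close>

lemma (in prob_space) lindeberg_step:
  fixes U L Y v :: "'a \<Rightarrow> real"
  assumes F: "subalgebra M F" and \<gamma>: "0 < \<gamma>"
    and UF: "U \<in> borel_measurable F" and LF: "L \<in> borel_measurable F" and vF: "v \<in> borel_measurable F"
    and Y [measurable]: "Y \<in> borel_measurable M"
    and Yb: "\<And>\<omega>. \<omega> \<in> space M \<Longrightarrow> \<bar>Y \<omega>\<bar> \<le> \<gamma>"
    and vb: "\<And>\<omega>. \<omega> \<in> space M \<Longrightarrow> 0 \<le> v \<omega> \<and> v \<omega> \<le> \<gamma>\<^sup>2"
    and Lb: "\<And>\<omega>. \<omega> \<in> space M \<Longrightarrow> (512 * \<gamma>)\<^sup>2 \<le> L \<omega>"
    and centred: "\<And>g C. g \<in> borel_measurable F \<Longrightarrow> (\<And>\<omega>. \<omega> \<in> space M \<Longrightarrow> \<bar>g \<omega>\<bar> \<le> C) \<Longrightarrow>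
      expectation (\<lambda>\<omega>. g \<omega> * Y \<omega>) = 0"
    and variance: "\<And>g C. g \<in> borel_measurable F \<Longrightarrow> (\<And>\<omega>. \<omega> \<in> space M \<Longrightarrow> \<bar>g \<omega>\<bar> \<le> C) \<Longrightarrow>
      expectation (\<lambda>\<omega>. g \<omega> * (Y \<omega>)\<^sup>2) = expectation (\<lambda>\<omega>. g \<omega> * v \<omega>)"
  shows "\<bar>expectation (\<lambda>\<omega>. heat (U \<omega> - Y \<omega>) (L \<omega>)) - expectation (\<lambda>\<omega>. heat (U \<omega>) (L \<omega> + v \<omega>))\<bar>
    \<le> 524288 * \<gamma> * (expectation (\<lambda>\<omega>. potential (U \<omega> - Y \<omega>) (L \<omega>)) -
                    expectation (\<lambda>\<omega>. potential (U \<omega>) (L \<omega> + v \<omega>)))"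
proof -
  note UF[measurable] LF[measurable] vF[measurable]
  define k where "k = 512 * \<gamma>"
  have k: "0 < k" and kL: "\<And>\<omega>. \<omega> \<in> space M \<Longrightarrow> k\<^sup>2 \<le> L \<omega>" using \<gamma> Lb by (auto simp: k_def)
  have kLv: "k\<^sup>2 \<le> L \<omega> + v \<omega>" if "\<omega> \<in> space M" for \<omega> using kL[OF that] vb[OF that] by simp
  have UM [measurable]: "U \<in> borel_measurable M" and LM [measurable]: "L \<in> borel_measurable M"
    and vM [measurable]: "v \<in> borel_measurable M"
    by (rule measurable_from_subalg[OF F UF] measurable_from_subalg[OF F LF] measurable_from_subalg[OF F vF])+
  have Y2b: "\<bar>(Y \<omega>)\<^sup>2\<bar> \<le> \<gamma>\<^sup>2" if "\<omega> \<in> space M" for \<omega>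
    using power_mono[OF Yb[OF that] abs_ge_zero, of 2] by simp
  define hr hrr pr prr c where
    "hr \<omega> = heat_r (U \<omega>) (L \<omega>)" and "hrr \<omega> = heat_rr (U \<omega>) (L \<omega>)" and
    "pr \<omega> = potential_r (U \<omega>) (L \<omega>)" and "prr \<omega> = potential_rr (U \<omega>) (L \<omega>)" and
    "c \<omega> = 1 / sqrt (2 * L \<omega> + (U \<omega>)\<^sup>2) ^ 3" for \<omega>
  have F_meas: "hr \<in> borel_measurable F" "hrr \<in> borel_measurable F" "pr \<in> borel_measurable F"
    "prr \<in> borel_measurable F" "c \<in> borel_measurable F"
    unfolding hr_def[abs_def] hrr_def[abs_def] pr_def[abs_def] prr_def[abs_def] c_def[abs_def]
    by measurable
  have M_meas [measurable]: "hr \<in> borel_measurable M" "hrr \<in> borel_measurable M" "pr \<in> borel_measurable M"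
    "prr \<in> borel_measurable M" "c \<in> borel_measurable M"
    using F_meas[THEN measurable_from_subalg[OF F]] by simp_all
  have bounds: "\<bar>hr \<omega>\<bar> \<le> 1 / k" "\<bar>hrr \<omega>\<bar> \<le> 4096 / k\<^sup>2" "\<bar>pr \<omega>\<bar> \<le> 1 / k\<^sup>2" "\<bar>prr \<omega>\<bar> \<le> 4 / k ^ 3"
    "\<bar>c \<omega>\<bar> \<le> 1 / k ^ 3" if "\<omega> \<in> space M" for \<omega>
  proof -
    note bd = heat_partials_bounded[OF k kL[OF that], of "U \<omega>"] potential_partials_bounded[OF k kL[OF that], of "U \<omega>"]
    show "\<bar>hr \<omega>\<bar> \<le> 1 / k" "\<bar>hrr \<omega>\<bar> \<le> 4096 / k\<^sup>2" "\<bar>pr \<omega>\<bar> \<le> 1 / k\<^sup>2" "\<bar>prr \<omega>\<bar> \<le> 4 / k ^ 3"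
      unfolding hr_def hrr_def pr_def prr_def by (fact bd)+
    have "0 \<le> sqrt (2 * L \<omega> + (U \<omega>)\<^sup>2)" using k bd(7) by linarith
    then have "\<bar>c \<omega>\<bar> = 1 / sqrt (2 * L \<omega> + (U \<omega>)\<^sup>2) ^ 3" unfolding c_def by (intro abs_of_nonneg) simp
    also have "\<dots> \<le> 1 / k ^ 3" using bd(7) k by (intro divide_power_antimono) auto
    finally show "\<bar>c \<omega>\<bar> \<le> 1 / k ^ 3" .
  qed
  have int_prod: "integrable M (\<lambda>\<omega>. g \<omega> * f \<omega>)"
    if "g \<in> borel_measurable M" "f \<in> borel_measurable M" "\<And>\<omega>. \<omega> \<in> space M \<Longrightarrow> \<bar>g \<omega>\<bar> \<le> A"
      "\<And>\<omega>. \<omega> \<in> space M \<Longrightarrow> \<bar>f \<omega>\<bar> \<le> B" for f g :: "'a \<Rightarrow> real" and A B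
  proof (rule integrable_bounded)
    show "\<bar>g \<omega> * f \<omega>\<bar> \<le> A * B" if "\<omega> \<in> space M" for \<omega>
      unfolding abs_mult using that \<open>\<And>\<omega>. \<omega> \<in> space M \<Longrightarrow> \<bar>g \<omega>\<bar> \<le> A\<close>[OF that]
        \<open>\<And>\<omega>. \<omega> \<in> space M \<Longrightarrow> \<bar>f \<omega>\<bar> \<le> B\<close>[OF that] by (intro mult_mono) auto
  qed (use that in measurable)
  have vb': "\<bar>v \<omega>\<bar> \<le> \<gamma>\<^sup>2" if "\<omega> \<in> space M" for \<omega> using vb[OF that] by simp
  note ints = int_prod[OF M_meas(1) Y bounds(1) Yb] int_prod[OF M_meas(3) Y bounds(3) Yb]
    int_prod[OF M_meas(2) borel_measurable_power[OF Y] bounds(2) Y2b] int_prod[OF M_meas(2) vM bounds(2) vb']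
    int_prod[OF M_meas(4) borel_measurable_power[OF Y] bounds(4) Y2b] int_prod[OF M_meas(4) vM bounds(4) vb']
    int_prod[OF M_meas(5) borel_measurable_power[OF Y] bounds(5) Y2b] int_prod[OF M_meas(5) vM bounds(5) vb']
  have int_heat: "integrable M (\<lambda>\<omega>. heat (U \<omega> - Y \<omega>) (L \<omega>))" "integrable M (\<lambda>\<omega>. heat (U \<omega>) (L \<omega> + v \<omega>))"
    by (rule integrable_bounded[of _ 1]; simp add: heat_bounds)+
  have int_pot: "integrable M (\<lambda>\<omega>. potential (U \<omega> - Y \<omega>) (L \<omega>))"
    "integrable M (\<lambda>\<omega>. potential (U \<omega>) (L \<omega> + v \<omega>))"
    using potential_partials_bounded(1,2)[OF k kL] potential_partials_bounded(1,2)[OF k kLv]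
    by (auto intro!: integrable_bounded[of _ "1/k"])
  let ?h = "\<lambda>\<omega>. heat (U \<omega> - Y \<omega>) (L \<omega>) - heat (U \<omega>) (L \<omega> + v \<omega>)"
  let ?p = "\<lambda>\<omega>. potential (U \<omega> - Y \<omega>) (L \<omega>) - potential (U \<omega>) (L \<omega> + v \<omega>)"
  define m where "m = expectation (\<lambda>\<omega>. c \<omega> * v \<omega>)"
  define Rh where "Rh \<omega> = ?h \<omega> + hr \<omega> * Y \<omega> - (hrr \<omega> * (Y \<omega>)\<^sup>2 - hrr \<omega> * v \<omega>) / 2" for \<omega>
  define Rp where "Rp \<omega> = ?p \<omega> + pr \<omega> * Y \<omega> - (prr \<omega> * (Y \<omega>)\<^sup>2 - prr \<omega> * v \<omega>) / 2" for \<omega>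
  have EY: "expectation (\<lambda>\<omega>. hr \<omega> * Y \<omega>) = 0" "expectation (\<lambda>\<omega>. pr \<omega> * Y \<omega>) = 0"
    using centred[OF F_meas(1) bounds(1)] centred[OF F_meas(3) bounds(3)] by auto
  have EY2: "expectation (\<lambda>\<omega>. hrr \<omega> * (Y \<omega>)\<^sup>2) = expectation (\<lambda>\<omega>. hrr \<omega> * v \<omega>)"
    "expectation (\<lambda>\<omega>. prr \<omega> * (Y \<omega>)\<^sup>2) = expectation (\<lambda>\<omega>. prr \<omega> * v \<omega>)"
    "expectation (\<lambda>\<omega>. c \<omega> * (Y \<omega>)\<^sup>2) = m"
    using variance[OF F_meas(2) bounds(2)] variance[OF F_meas(4) bounds(4)] variance[OF F_meas(5) bounds(5)]
    by (auto simp: m_def)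
  have int_Rh: "integrable M Rh" and int_Rp: "integrable M Rp"
    unfolding Rh_def[abs_def] Rp_def[abs_def] using ints int_heat int_pot by auto
  have ERh: "expectation ?h = expectation Rh"
    unfolding Rh_def[abs_def] using ints int_heat EY EY2 by simp
  have ERp: "expectation ?p = expectation Rp"
    unfolding Rp_def[abs_def] using ints int_pot EY EY2 by simp
  have "\<bar>expectation Rh\<bar> \<le> expectation (\<lambda>\<omega>. \<bar>Rh \<omega>\<bar>)" by (rule integral_abs_bound)
  also have "\<dots> \<le> expectation (\<lambda>\<omega>. 65536 * \<gamma> * (c \<omega> * (Y \<omega>)\<^sup>2 + c \<omega> * v \<omega>))"
  proof (rule integral_mono)
    fix \<omega> assume w: "\<omega> \<in> space M"
    have "\<gamma>\<^sup>2 \<le> k\<^sup>2" unfolding k_def using \<gamma> by (intro power_mono) auto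
    then have "\<gamma>\<^sup>2 \<le> L \<omega>" using kL[OF w] by linarith
    from heat_expansion[OF \<gamma> this Yb[OF w], of "v \<omega>" "U \<omega>"] vb[OF w]
    show "\<bar>Rh \<omega>\<bar> \<le> 65536 * \<gamma> * (c \<omega> * (Y \<omega>)\<^sup>2 + c \<omega> * v \<omega>)"
      by (simp add: Rh_def hr_def hrr_def c_def right_diff_distrib add_divide_distrib distrib_left)
  qed (use ints int_Rh in auto)
  also have "\<dots> = 131072 * \<gamma> * m" using ints EY2 by (simp add: m_def)
  finally have h: "\<bar>expectation ?h\<bar> \<le> 131072 * \<gamma> * m" by (simp add: ERh)
  have "m / 4 = expectation (\<lambda>\<omega>. c \<omega> * v \<omega> / 2 - (c \<omega> * (Y \<omega>)\<^sup>2 + c \<omega> * v \<omega>) / 8)"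
    using ints EY2 by (simp add: m_def)
  also have "\<dots> \<le> expectation Rp"
  proof (rule integral_mono)
    fix \<omega> assume w: "\<omega> \<in> space M"
    show "c \<omega> * v \<omega> / 2 - (c \<omega> * (Y \<omega>)\<^sup>2 + c \<omega> * v \<omega>) / 8 \<le> Rp \<omega>"
      using potential_expansion[OF \<gamma> Lb[OF w] Yb[OF w], of "v \<omega>" "U \<omega>"] vb[OF w]
      by (simp add: Rp_def pr_def prr_def c_def right_diff_distrib add_divide_distrib distrib_left)
  qed (use ints int_Rp in auto)
  finally have p: "m / 4 \<le> expectation ?p" by (simp add: ERp)
  have "131072 * \<gamma> * m = 524288 * \<gamma> * (m / 4)" by simp
  also have "\<dots> \<le> 524288 * \<gamma> * expectation ?p" using p \<gamma> by (intro mult_left_mono) auto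
  finally have "\<bar>expectation ?h\<bar> \<le> 524288 * \<gamma> * expectation ?p" using h by linarith
  then show ?thesis using int_heat int_pot by simp
qed

text \<open>
  \<open>F i\<close> is the information available before step \<open>i\<close>, and \<open>v i\<close> is the conditional variance
  of \<open>Y i\<close> given \<open>F i\<close>. The conditional variances are predictable and their sum is bounded
  by the constant \<open>B\<close>, so the variance \<open>B - (v 1 + \<dots> + v i)\<close> remaining after step \<open>i\<close>
  is nonnegative and known before that step.
\<close>

locale bounded_martingale = prob_space M for M :: "'a measure" +
  fixes F :: "nat \<Rightarrow> 'a measure" and Y v :: "nat \<Rightarrow> 'a \<Rightarrow> real" and n :: nat and \<gamma> B :: real
  assumes \<gamma>: "0 < \<gamma>"
    and subalg: "\<And>i. i \<in> {1..n} \<Longrightarrow> subalgebra M (F i)"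
    and Y_measurable: "\<And>i. i \<in> {1..n} \<Longrightarrow> Y i \<in> borel_measurable M"
    and Y_past: "\<And>i j. i \<in> {1..n} \<Longrightarrow> j \<in> {1..<i} \<Longrightarrow> Y j \<in> borel_measurable (F i)"
    and v_past: "\<And>i j. i \<in> {1..n} \<Longrightarrow> j \<in> {1..i} \<Longrightarrow> v j \<in> borel_measurable (F i)"
    and Y_bound: "\<And>i \<omega>. i \<in> {1..n} \<Longrightarrow> \<omega> \<in> space M \<Longrightarrow> \<bar>Y i \<omega>\<bar> \<le> \<gamma>"
    and v_bound: "\<And>i \<omega>. i \<in> {1..n} \<Longrightarrow> \<omega> \<in> space M \<Longrightarrow> 0 \<le> v i \<omega> \<and> v i \<omega> \<le> \<gamma>\<^sup>2"
    and centred: "\<And>i g C. i \<in> {1..n} \<Longrightarrow> g \<in> borel_measurable (F i) \<Longrightarrow>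
      (\<And>\<omega>. \<omega> \<in> space M \<Longrightarrow> \<bar>g \<omega>\<bar> \<le> C) \<Longrightarrow> expectation (\<lambda>\<omega>. g \<omega> * Y i \<omega>) = 0"
    and cond_variance: "\<And>i g C. i \<in> {1..n} \<Longrightarrow> g \<in> borel_measurable (F i) \<Longrightarrow>
      (\<And>\<omega>. \<omega> \<in> space M \<Longrightarrow> \<bar>g \<omega>\<bar> \<le> C) \<Longrightarrow>
      expectation (\<lambda>\<omega>. g \<omega> * (Y i \<omega>)\<^sup>2) = expectation (\<lambda>\<omega>. g \<omega> * v i \<omega>)"
    and total_variance: "\<And>\<omega>. \<omega> \<in> space M \<Longrightarrow> (\<Sum>i=1..n. v i \<omega>) \<le> B"
begin

lemma partial_variance:
  assumes "m \<le> n" "\<omega> \<in> space M" shows "(\<Sum>i=1..m. v i \<omega>) \<le> B"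
proof -
  have "(\<Sum>i=1..m. v i \<omega>) \<le> (\<Sum>i=1..n. v i \<omega>)"
    using assms v_bound by (intro sum_mono2) auto
  then show ?thesis using total_variance[OF assms(2)] by linarith
qed

text \<open>
  The extra variance \<open>k\<^sup>2\<close> keeps the remaining variance above \<open>(512 \<gamma>)\<^sup>2\<close> in every step.
  Since the error of each step is bounded by the increment of the same function, both sides
  telescope.
\<close>

lemma lindeberg_telescope:
  assumes "512 * \<gamma> \<le> k" "m \<le> n"
  shows "\<bar>expectation (\<lambda>\<omega>. heat (t - (\<Sum>i=1..m. Y i \<omega>)) (B + k\<^sup>2 - (\<Sum>i=1..m. v i \<omega>))) - heat t (B + k\<^sup>2)\<bar>
    \<le> 524288 * \<gamma> * (expectation (\<lambda>\<omega>. potential (t - (\<Sum>i=1..m. Y i \<omega>)) (B + k\<^sup>2 - (\<Sum>i=1..m. v i \<omega>)))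
        - potential t (B + k\<^sup>2))"
  using assms(2)
proof (induction m)
  case 0
  then show ?case by (simp add: prob_space)
next
  case (Suc m)
  let ?U = "\<lambda>\<omega>. t - (\<Sum>i=1..m. Y i \<omega>)" and ?L = "\<lambda>\<omega>. B + k\<^sup>2 - (\<Sum>i=1..Suc m. v i \<omega>)"
  have i: "Suc m \<in> {1..n}" using Suc.prems by simp
  have "(512 * \<gamma>)\<^sup>2 \<le> k\<^sup>2" using assms(1) \<gamma> by (intro power_mono) auto
  then have L: "(512 * \<gamma>)\<^sup>2 \<le> ?L \<omega>" if "\<omega> \<in> space M" for \<omega>
    using partial_variance[OF Suc.prems that] by linarith
  have "\<bar>expectation (\<lambda>\<omega>. heat (?U \<omega> - Y (Suc m) \<omega>) (?L \<omega>)) - expectation (\<lambda>\<omega>. heat (?U \<omega>) (?L \<omega> + v (Suc m) \<omega>))\<bar>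
    \<le> 524288 * \<gamma> * (expectation (\<lambda>\<omega>. potential (?U \<omega> - Y (Suc m) \<omega>) (?L \<omega>)) -
                    expectation (\<lambda>\<omega>. potential (?U \<omega>) (?L \<omega> + v (Suc m) \<omega>)))"
  proof (rule lindeberg_step[OF subalg[OF i] \<gamma>])
    show "?U \<in> borel_measurable (F (Suc m))"
      by (intro borel_measurable_diff borel_measurable_sum borel_measurable_const Y_past[OF i]) auto
    show "?L \<in> borel_measurable (F (Suc m))"
      by (intro borel_measurable_diff borel_measurable_sum borel_measurable_const v_past[OF i]) auto
    show "expectation (\<lambda>\<omega>. g \<omega> * Y (Suc m) \<omega>) = 0"
      if "g \<in> borel_measurable (F (Suc m))" "\<And>\<omega>. \<omega> \<in> space M \<Longrightarrow> \<bar>g \<omega>\<bar> \<le> C" for g C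
      using centred[OF i that] .
    show "expectation (\<lambda>\<omega>. g \<omega> * (Y (Suc m) \<omega>)\<^sup>2) = expectation (\<lambda>\<omega>. g \<omega> * v (Suc m) \<omega>)"
      if "g \<in> borel_measurable (F (Suc m))" "\<And>\<omega>. \<omega> \<in> space M \<Longrightarrow> \<bar>g \<omega>\<bar> \<le> C" for g C
      using cond_variance[OF i that] .
    show "v (Suc m) \<in> borel_measurable (F (Suc m))" using v_past[OF i] by simp
  qed (use Y_measurable[OF i] Y_bound[OF i] v_bound[OF i] L in auto)
  moreover have "?U \<omega> - Y (Suc m) \<omega> = t - (\<Sum>i=1..Suc m. Y i \<omega>)"
    "?L \<omega> + v (Suc m) \<omega> = B + k\<^sup>2 - (\<Sum>i=1..m. v i \<omega>)" for \<omega> by simp_all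
  ultimately show ?case using Suc.IH Suc.prems by (simp only: right_diff_distrib) linarith
qed

lemma heat_le_potential:
  assumes "512 * \<gamma> \<le> k" "0 \<le> B"
  shows "\<bar>expectation (\<lambda>\<omega>. heat (t - (\<Sum>i=1..n. Y i \<omega>)) (B + k\<^sup>2 - (\<Sum>i=1..n. v i \<omega>))) - Phi (t / sqrt (B + k\<^sup>2))\<bar>
    \<le> 524288 * \<gamma> * expectation (\<lambda>\<omega>. potential (t - (\<Sum>i=1..n. Y i \<omega>)) (B + k\<^sup>2 - (\<Sum>i=1..n. v i \<omega>)))"
proof -
  have "0 \<le> potential t (B + k\<^sup>2)" using assms(2) by (simp add: potential_def)
  then have "0 \<le> 524288 * \<gamma> * potential t (B + k\<^sup>2)" using \<gamma> by simp
  then show ?thesis using lindeberg_telescope[OF assms(1) order_refl, of t]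
    unfolding right_diff_distrib heat_def[of t] by linarith
qed

end

section \<open>From smoothed to unsmoothed distribution functions\<close>

text \<open>
  A function bounded by \<open>min (1/k) (1/\<bar>r\<bar>)\<close> is dominated by a sum of indicators of intervals
  of lengths \<open>2\<^sup>j k\<close>. Probabilities of intervals are controlled by the Kolmogorov distance,
  each at the price of the same error, and the weights \<open>2 / (2\<^sup>j k)\<close> make these errors
  summable.
\<close>

lemma inverse_le_dyadic_sum:
  fixes a k r :: real
  assumes "0 < k" "1 / k \<ge> a" "\<bar>r\<bar> * a \<le> 1" "0 \<le> a"
  shows "a \<le> (\<Sum>j\<le>J. 2 / (2 ^ j * k) * indicator {- (2 ^ j * k)..2 ^ j * k} r) + 1 / (2 ^ J * k)"
proof -
  let ?f = "\<lambda>j. 2 / (2 ^ j * k) * indicator {- (2 ^ j * k)..2 ^ j * k} (r::real)"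
  have nn: "0 \<le> ?f j" for j using assms(1) by simp
  show ?thesis
  proof (cases "\<exists>j\<le>J. \<bar>r\<bar> \<le> 2 ^ j * k")
    case True
    define i where "i = (LEAST j. \<bar>r\<bar> \<le> 2 ^ j * k)"
    have i: "\<bar>r\<bar> \<le> 2 ^ i * k" unfolding i_def using True by (auto intro: LeastI)
    have iJ: "i \<le> J" unfolding i_def using True by (meson Least_le order_trans)
    have "a \<le> 2 / (2 ^ i * k)"
    proof (cases i)
      case 0
      then show ?thesis using assms(1,2) by (simp add: order_trans[OF assms(2)] divide_right_mono)
    next
      case (Suc l)
      then have "2 ^ l * k < \<bar>r\<bar>" using not_less_Least[of l "\<lambda>j. \<bar>r\<bar> \<le> 2 ^ j * k"] by (simp add: i_def)
      then have "2 ^ l * k * a \<le> \<bar>r\<bar> * a" using assms(4) by (intro mult_right_mono) auto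
      then have "a * (2 ^ l * k) \<le> 1" using assms(3) by (simp add: mult.commute)
      then have "a \<le> 1 / (2 ^ l * k)" using assms(1) by (simp add: pos_le_divide_eq)
      then show ?thesis by (simp add: Suc)
    qed
    also have "\<dots> = ?f i" using i by (simp add: indicator_def abs_le_iff)
    also have "\<dots> \<le> (\<Sum>j\<le>J. ?f j)" using iJ nn by (intro member_le_sum) auto
    finally show ?thesis using assms(1) by (simp add: add_increasing2)
  next
    case False
    then have "2 ^ J * k < \<bar>r\<bar>" by force
    then have "2 ^ J * k * a \<le> \<bar>r\<bar> * a" using assms(4) by (intro mult_right_mono) auto
    then have "a * (2 ^ J * k) \<le> 1" using assms(3) by (simp add: mult.commute)
    then have "a \<le> 1 / (2 ^ J * k)" using assms(1) by (simp add: pos_le_divide_eq)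
    then show ?thesis using nn by (simp add: sum_nonneg add_increasing)
  qed
qed

text \<open>
  A lower bound for \<open>\<Phi>\<close> by a step function that jumps at 2, 4, 6, \<dots>. Its first jump \<open>3/4\<close> is
  larger than \<open>1/2\<close>, its jumps sum up to nearly 1, and they decay so fast that the sum of jump
  times position stays bounded. For \<open>i \<ge> 1\<close> and \<open>y \<in> [2 i, 2 i + 2)\<close> the step
  function is at most \<open>1 - 2\<^sup>-\<^sup>i\<^sup>-\<^sup>1\<close>, and \<open>1 - \<Phi>(y) \<le> e\<^sup>-\<^sup>2\<^sup>i \<le> 4\<^sup>-\<^sup>i\<close>.
\<close>

lemma Phi_ge_step:
  "(3 / 4) * indicator {2..} y + (\<Sum>j=2..J. (1/2::real) ^ (j + 1) * indicator {2 * real j..} y) \<le> Phi y"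
proof -
  have step: "(3 / 4) * indicator {2..} y + (\<Sum>j=2..J. (1/2::real) ^ (j + 1) * indicator {2 * real j..} y)
     \<le> 1 - (1/2) ^ (i + 1)" if "y < 2 * real (i + 1)" "1 \<le> i" for i
  proof -
    have "(\<Sum>j=2..J. (1/2::real) ^ (j + 1) * indicator {2 * real j..} y) \<le> (\<Sum>j=2..i. (1/2::real) ^ (j + 1))"
    proof -
      have "(\<Sum>j=2..J. (1/2::real) ^ (j + 1) * indicator {2 * real j..} y)
        = (\<Sum>j\<in>{2..J} \<inter> {..i}. (1/2::real) ^ (j + 1) * indicator {2 * real j..} y)"
        using that by (intro sum.mono_neutral_right) (auto simp: indicator_def)
      also have "\<dots> \<le> (\<Sum>j\<in>{2..J} \<inter> {..i}. (1/2::real) ^ (j + 1))"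
        by (intro sum_mono) (simp add: indicator_def)
      also have "\<dots> \<le> (\<Sum>j=2..i. (1/2) ^ (j + 1))" by (intro sum_mono2) auto
      finally show ?thesis .
    qed
    also have "\<dots> = 1 / 4 - (1/2) ^ (i + 1)"
      using that(2) by (induction i rule: dec_induct) (auto simp: field_simps)
    finally show ?thesis by (auto simp: indicator_def)
  qed
  show ?thesis
  proof (cases "y < 2")
    case True
    then have "(\<Sum>j=2..J. (1/2::real) ^ (j + 1) * indicator {2 * real j..} y) = (0::real)"
      by (intro sum.neutral) (auto simp: indicator_def)
    then show ?thesis using True std_normal.cdf_nonneg[of y] by simp
  next
    case False
    define i where "i = nat \<lfloor>y / 2\<rfloor>"
    have "1 \<le> \<lfloor>y / 2\<rfloor>" using False by simp
    then have "int i = \<lfloor>y / 2\<rfloor>" by (simp add: i_def)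
    then have i: "1 \<le> i" "real i = of_int \<lfloor>y / 2\<rfloor>" using \<open>1 \<le> \<lfloor>y / 2\<rfloor>\<close> by linarith+
    have "real i \<le> y / 2" "y / 2 < real i + 1"
      unfolding i(2) by (rule of_int_floor_le real_of_int_floor_add_one_gt)+
    then have yi: "2 * real i \<le> y" "y < 2 * real (i + 1)" by simp_all
    have "1 - Phi y \<le> exp (- y)" by (rule Phi_tail)
    also have "\<dots> \<le> exp (- (2 * real i))" using yi by simp
    also have "\<dots> = exp (- 2) ^ i" by (simp add: exp_of_nat_mult[symmetric] mult.commute)
    also have "\<dots> \<le> (1/4) ^ i"
    proof (rule power_mono)
      have "2 \<le> exp (1::real)" using exp_ge_add_one_self[of 1] by simp
      then have "2 * 2 \<le> exp (1::real) * exp 1" by (intro mult_mono) auto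
      then show "exp (- 2) \<le> (1/4 :: real)" by (simp add: exp_minus flip: exp_add) (simp add: field_simps)
    qed simp
    also have "\<dots> = (1/2) ^ (i + i)" by (simp add: power_add flip: power_mult_distrib)
    also have "\<dots> \<le> (1/2) ^ (i + 1)" using i by (intro power_decreasing) auto
    finally show ?thesis using step[OF yi(2) i(1)] by linarith
  qed
qed

context prob_space
begin

lemma prob_interval_le:
  fixes S :: "'a \<Rightarrow> real"
  assumes [measurable]: "S \<in> borel_measurable M" and "0 < s" "0 < a"
    and close: "\<And>t. \<bar>prob {\<omega> \<in> space M. S \<omega> \<le> t} - Phi (t / s)\<bar> \<le> \<delta>"
  shows "prob {\<omega> \<in> space M. \<bar>t - S \<omega>\<bar> \<le> a} \<le> 3 * a / s + 2 * \<delta>"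
proof -
  have "{\<omega> \<in> space M. \<bar>t - S \<omega>\<bar> \<le> a} \<subseteq> {\<omega> \<in> space M. S \<omega> \<le> t + a} - {\<omega> \<in> space M. S \<omega> \<le> t - 2 * a}"
    using \<open>0 < a\<close> by auto
  then have "prob {\<omega> \<in> space M. \<bar>t - S \<omega>\<bar> \<le> a}
    \<le> prob ({\<omega> \<in> space M. S \<omega> \<le> t + a} - {\<omega> \<in> space M. S \<omega> \<le> t - 2 * a})"
    by (intro finite_measure_mono) auto
  also have "\<dots> = prob {\<omega> \<in> space M. S \<omega> \<le> t + a} - prob {\<omega> \<in> space M. S \<omega> \<le> t - 2 * a}"
    using \<open>0 < a\<close> by (intro finite_measure_Diff) auto
  also have "\<dots> \<le> \<bar>(t + a) / s - (t - 2 * a) / s\<bar> + 2 * \<delta>"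
    using close[of "t + a"] close[of "t - 2 * a"] Phi_lipschitz[of "(t + a) / s" "(t - 2 * a) / s"] by linarith
  also have "(t + a) / s - (t - 2 * a) / s = 3 * a / s" by (simp flip: diff_divide_distrib)
  finally show ?thesis using \<open>0 < a\<close> \<open>0 < s\<close> by simp
qed

lemma expectation_potential_le:
  fixes S L :: "'a \<Rightarrow> real"
  assumes [measurable]: "S \<in> borel_measurable M" and "0 < s" "0 < k"
    and L: "\<And>\<omega>. \<omega> \<in> space M \<Longrightarrow> k\<^sup>2 \<le> L \<omega>"
    and close: "\<And>t. \<bar>prob {\<omega> \<in> space M. S \<omega> \<le> t} - Phi (t / s)\<bar> \<le> \<delta>"
  shows "expectation (\<lambda>\<omega>. potential (t - S \<omega>) (L \<omega>)) \<le> 6 * (real J + 1) / s + 8 * \<delta> / k + 1 / (2 ^ J * k)"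
proof -
  have \<delta>: "0 \<le> \<delta>" using close[of 0] by linarith
  let ?I = "\<lambda>j \<omega>. indicator {\<omega> \<in> space M. \<bar>t - S \<omega>\<bar> \<le> 2 ^ j * k} \<omega> :: real"
  let ?g = "\<lambda>\<omega>. (\<Sum>j\<le>J. 2 / (2 ^ j * k) * ?I j \<omega>) + 1 / (2 ^ J * k)"
  have int: "integrable M (?I j)" for j :: nat
    by (intro integrable_real_indicator) (auto simp: emeasure_eq_measure)
  have "expectation (\<lambda>\<omega>. potential (t - S \<omega>) (L \<omega>)) \<le> expectation ?g"
  proof (rule integral_mono')
    show "integrable M ?g" using int by auto
    fix \<omega> assume w: "\<omega> \<in> space M"
    define r where "r = t - S \<omega>"
    have Lp: "0 < L \<omega>" using L[OF w] \<open>0 < k\<close> zero_less_power[of k 2] by linarith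
    have 1: "k \<le> sqrt (2 * L \<omega> + r\<^sup>2)" using L[OF w] Lp by (intro real_le_rsqrt) (simp add: add_increasing2)
    have 2: "\<bar>r\<bar> \<le> sqrt (2 * L \<omega> + r\<^sup>2)" using Lp by (intro real_le_rsqrt) simp
    have "potential r (L \<omega>) \<le> (\<Sum>j\<le>J. 2 / (2 ^ j * k) * indicator {- (2 ^ j * k)..2 ^ j * k} r) + 1 / (2 ^ J * k)"
    proof (rule inverse_le_dyadic_sum)
      show "potential r (L \<omega>) \<le> 1 / k" using 1 \<open>0 < k\<close> by (simp add: potential_def frac_le)
      show "\<bar>r\<bar> * potential r (L \<omega>) \<le> 1"
      proof -
        have "0 < sqrt (2 * L \<omega> + r\<^sup>2)" using 1 \<open>0 < k\<close> by linarith
        then show ?thesis using 2 by (simp only: potential_def times_divide_eq_right mult_1_right divide_le_eq_1_pos)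
      qed
    qed (use \<open>0 < k\<close> Lp in \<open>auto simp: potential_def\<close>)
    also have "\<dots> = ?g \<omega>"
    proof -
      have "indicator {- (2 ^ j * k)..2 ^ j * k} r = ?I j \<omega>" for j
        using w by (auto simp: indicator_def r_def abs_le_iff)
      then show ?thesis by simp
    qed
    finally show "potential (t - S \<omega>) (L \<omega>) \<le> ?g \<omega>" by (simp add: r_def)
    show "0 \<le> ?g \<omega>" using \<open>0 < k\<close> by (auto intro!: add_nonneg_nonneg sum_nonneg)
  qed
  also have "\<dots> = (\<Sum>j\<le>J. 2 / (2 ^ j * k) * prob {\<omega> \<in> space M. \<bar>t - S \<omega>\<bar> \<le> 2 ^ j * k}) + 1 / (2 ^ J * k)"
    using int by (simp add: prob_space)
  also have "(\<Sum>j\<le>J. 2 / (2 ^ j * k) * prob {\<omega> \<in> space M. \<bar>t - S \<omega>\<bar> \<le> 2 ^ j * k})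
    \<le> (\<Sum>j\<le>J. 6 / s + 4 * \<delta> / k * (1/2) ^ j)"
  proof (rule sum_mono)
    fix j
    have "prob {\<omega> \<in> space M. \<bar>t - S \<omega>\<bar> \<le> 2 ^ j * k} \<le> 3 * (2 ^ j * k) / s + 2 * \<delta>"
      using \<open>0 < s\<close> \<open>0 < k\<close> close by (intro prob_interval_le) auto
    then have "2 / (2 ^ j * k) * prob {\<omega> \<in> space M. \<bar>t - S \<omega>\<bar> \<le> 2 ^ j * k}
      \<le> 2 / (2 ^ j * k) * (3 * (2 ^ j * k) / s + 2 * \<delta>)"
      using \<open>0 < k\<close> by (intro mult_left_mono) auto
    also have "\<dots> = 6 / s + 4 * \<delta> / k * (1/2) ^ j"
      using \<open>0 < k\<close> \<open>0 < s\<close> by (simp add: field_simps power_divide)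
    finally show "2 / (2 ^ j * k) * prob {\<omega> \<in> space M. \<bar>t - S \<omega>\<bar> \<le> 2 ^ j * k} \<le> 6 / s + 4 * \<delta> / k * (1/2) ^ j" .
  qed
  also have "\<dots> = 6 * (real J + 1) / s + 4 * \<delta> / k * (\<Sum>j\<le>J. (1/2) ^ j)"
    by (simp add: sum.distrib sum_distrib_left field_simps)
  also have "4 * \<delta> / k * (\<Sum>j\<le>J. (1/2) ^ j) \<le> 4 * \<delta> / k * 2"
  proof (intro mult_left_mono)
    have "(\<Sum>j\<le>J. (1/2::real) ^ j) = 2 - (1/2) ^ J" by (induction J) auto
    then show "(\<Sum>j\<le>J. (1/2::real) ^ j) \<le> 2" by simp
  qed (use \<delta> \<open>0 < k\<close> in auto)
  finally show ?thesis by simp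
qed

text \<open>
  Smoothing can be undone although the smoothing variance \<open>L\<close> is random and depends on \<open>S\<close>,
  provided that \<open>\<surd>L\<close> rarely exceeds \<open>\<beta>\<close>. At the level \<open>t + 2 \<beta>\<close>, the step function below
  \<open>\<Phi>\<close> gives \<open>E heat \<ge> 3/4 P(S \<le> t) + \<Sum>\<^sub>j c\<^sub>j P(S \<le> t - 2 (j - 1) \<beta>) - x\<close>.
  The probabilities in the sum, of total weight nearly \<open>1/4\<close>, are at least
  \<open>\<Phi>(t / s) - \<delta> - O(j \<beta> / s)\<close>, so the unknown \<open>\<delta>\<close> enters with the factor \<open>1/4\<close> only,
  less than the factor \<open>3/4\<close> on the left.
\<close>

lemma smoothing_one_sided:
  fixes S L :: "'a \<Rightarrow> real"
  assumes [measurable]: "S \<in> borel_measurable M" "L \<in> borel_measurable M" and "0 < s" "0 < \<beta>"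
    and Lpos: "\<And>\<omega>. \<omega> \<in> space M \<Longrightarrow> 0 < L \<omega>"
    and Lx: "prob {\<omega> \<in> space M. \<beta>\<^sup>2 < L \<omega>} \<le> x"
    and heat_close: "\<And>t. expectation (\<lambda>\<omega>. heat (t - S \<omega>) (L \<omega>)) \<le> Phi (t / s) + \<epsilon>"
    and \<delta>: "0 \<le> \<delta>"
    and lower: "\<And>t. Phi (t / s) - \<delta> \<le> prob {\<omega> \<in> space M. S \<omega> \<le> t}"
  shows "3 / 4 * (prob {\<omega> \<in> space M. S \<omega> \<le> t} - Phi (t / s)) \<le> \<epsilon> + \<delta> / 4 + 3 * \<beta> / s + x"
proof -
  define P where "P u = prob {\<omega> \<in> space M. S \<omega> \<le> u}" for u
  \<comment> \<open>The geometric tail beyond the index \<open>J\<close> costs \<open>2\<^sup>-\<^sup>J\<^sup>-\<^sup>1\<close>, and \<open>J\<close> is arbitrary.\<close>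
  have approx: "3 / 4 * (P t - Phi (t / s)) \<le> \<epsilon> + \<delta> / 4 + 3 * \<beta> / s + x + (1/2) ^ (J + 1)" if "1 \<le> J" for J
  proof -
    define c where "c j = (1/2::real) ^ (j + 1)" for j :: nat
    let ?bad = "{\<omega> \<in> space M. \<beta>\<^sup>2 < L \<omega>}"
    define I where "I j = (indicator {\<omega> \<in> space M. S \<omega> \<le> t + 2 * \<beta> - 2 * real j * \<beta>} :: 'a \<Rightarrow> real)" for j
    define b where "b = (indicator ?bad :: 'a \<Rightarrow> real)"
    let ?g = "\<lambda>\<omega>. 3 / 4 * I 1 \<omega> + (\<Sum>j=2..J. c j * I j \<omega>) - b \<omega>"
    have int: "integrable M (I j)" "integrable M b" for j
      unfolding I_def b_def by (intro integrable_real_indicator; auto simp: emeasure_eq_measure)+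
    have EI: "expectation (I j) = P (t + 2 * \<beta> - 2 * real j * \<beta>)" "expectation b = prob ?bad" for j
      by (simp_all add: I_def b_def P_def)
    have step: "?g \<omega> \<le> heat (t + 2 * \<beta> - S \<omega>) (L \<omega>)" if w: "\<omega> \<in> space M" for \<omega>
    proof -
      define r where "r = t + 2 * \<beta> - S \<omega>"
      have I: "I j \<omega> = indicator {2 * real j..} (r / \<beta>)" for j
        using w \<open>0 < \<beta>\<close> by (auto simp: I_def indicator_def r_def pos_le_divide_eq)
      let ?step = "(3 / 4) * indicator {2..} (r / \<beta>) + (\<Sum>j=2..J. c j * indicator {2 * real j..} (r / \<beta>))"
      have eq: "?g \<omega> = ?step - indicator ?bad \<omega>" by (simp only: I b_def) simp
      have le: "?step \<le> Phi (r / \<beta>)" unfolding c_def by (rule Phi_ge_step)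
      show ?thesis
      \<comment> \<open>For \<open>r \<ge> 0\<close> a smaller variance increases \<open>heat r L\<close>; for \<open>r < 0\<close> the step function vanishes.\<close>
      proof (cases "\<omega> \<in> ?bad")
        case True
        then show ?thesis using le std_normal.cdf_bounded_prob[of "r / \<beta>"]
            std_normal.cdf_nonneg[of "r / sqrt (L \<omega>)"]
          unfolding eq by (simp add: heat_def flip: r_def)
      next
        case False
        then have "L \<omega> \<le> \<beta>\<^sup>2" using w by auto
        then have sL: "0 < sqrt (L \<omega>)" "sqrt (L \<omega>) \<le> \<beta>"
          using Lpos[OF w] \<open>0 < \<beta>\<close> by (auto intro: real_le_lsqrt)
        show ?thesis
        proof (cases "0 \<le> r")
          case True
          then have "r / \<beta> \<le> r / sqrt (L \<omega>)" using sL \<open>0 < \<beta>\<close> by (intro divide_left_mono mult_pos_pos) auto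
          then have "Phi (r / \<beta>) \<le> heat r (L \<omega>)" unfolding heat_def by (rule std_normal.cdf_nondecreasing)
          then show ?thesis using le False unfolding eq by (simp flip: r_def)
        next
          case neg: False
          have "r / \<beta> < 0" using neg \<open>0 < \<beta>\<close> by (simp add: divide_neg_pos)
          then have "?step = 0" by (auto simp: indicator_def intro!: sum.neutral)
          then show ?thesis using False std_normal.cdf_nonneg unfolding eq by (simp add: heat_def)
        qed
      qed
    qed
    have "3 / 4 * P t + (\<Sum>j=2..J. c j * P (t + 2 * \<beta> - 2 * real j * \<beta>)) - prob ?bad = expectation ?g"
      using int EI(1)[of 1] by (simp add: EI)
    also have "\<dots> \<le> expectation (\<lambda>\<omega>. heat (t + 2 * \<beta> - S \<omega>) (L \<omega>))"
    proof (rule integral_mono)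
      show "integrable M (\<lambda>\<omega>. heat (t + 2 * \<beta> - S \<omega>) (L \<omega>))"
        by (rule integrable_bounded[of _ 1]) (simp_all add: heat_bounds)
    qed (use int step in auto)
    also have "\<dots> \<le> Phi ((t + 2 * \<beta>) / s) + \<epsilon>" by (rule heat_close)
    also have "Phi ((t + 2 * \<beta>) / s) \<le> Phi (t / s) + 2 * \<beta> / s"
      using Phi_lipschitz[of "(t + 2 * \<beta>) / s" "t / s"] \<open>0 < \<beta>\<close> \<open>0 < s\<close> by (simp add: add_divide_distrib)
    finally have main: "3 / 4 * P t + (\<Sum>j=2..J. c j * P (t + 2 * \<beta> - 2 * real j * \<beta>))
      \<le> Phi (t / s) + 2 * \<beta> / s + \<epsilon> + x" using Lx by linarith
    have "(\<Sum>j=2..J. c j * (Phi (t / s) - \<delta> - 2 * (real j - 1) * (\<beta> / s)))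
      \<le> (\<Sum>j=2..J. c j * P (t + 2 * \<beta> - 2 * real j * \<beta>))"
    proof (intro sum_mono mult_left_mono)
      fix j assume "j \<in> {2..J}"
      have eq: "t / s - (t + 2 * \<beta> - 2 * real j * \<beta>) / s = 2 * (real j - 1) * (\<beta> / s)"
        using \<open>0 < s\<close> by (simp add: field_simps)
      have nn: "0 \<le> 2 * (real j - 1) * (\<beta> / s)"
        using \<open>j \<in> {2..J}\<close> \<open>0 < s\<close> \<open>0 < \<beta>\<close> by simp
      have "Phi (t / s) - 2 * (real j - 1) * (\<beta> / s) \<le> Phi ((t + 2 * \<beta> - 2 * real j * \<beta>) / s)"
        using Phi_lipschitz[of "t / s" "(t + 2 * \<beta> - 2 * real j * \<beta>) / s"]
        unfolding eq abs_of_nonneg[OF nn] by linarith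
      then show "Phi (t / s) - \<delta> - 2 * (real j - 1) * (\<beta> / s) \<le> P (t + 2 * \<beta> - 2 * real j * \<beta>)"
        using lower[of "t + 2 * \<beta> - 2 * real j * \<beta>"] unfolding P_def by linarith
    qed (simp add: c_def)
    moreover have "(\<Sum>j=2..J. c j * (Phi (t / s) - \<delta> - 2 * (real j - 1) * (\<beta> / s)))
      = (Phi (t / s) - \<delta>) * (\<Sum>j=2..J. c j) - (\<beta> / s) * (\<Sum>j=2..J. c j * (2 * (real j - 1)))"
      unfolding sum_distrib_left sum_subtractf[symmetric] by (intro sum.cong refl) (simp add: algebra_simps)
    moreover have "(\<Sum>j=2..J. c j) = 1 / 4 - (1/2) ^ (J + 1)"
      using that by (induction J rule: dec_induct) (auto simp: c_def field_simps)
    moreover have "(\<Sum>j=2..J. c j * (2 * (real j - 1))) = 1 - (real J + 1) * (1/2) ^ J"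
      using that by (induction J rule: dec_induct) (auto simp: c_def field_simps)
    ultimately have low: "(Phi (t / s) - \<delta>) * (1 / 4 - (1/2) ^ (J + 1)) - (\<beta> / s) * (1 - (real J + 1) * (1/2) ^ J)
      \<le> (\<Sum>j=2..J. c j * P (t + 2 * \<beta> - 2 * real j * \<beta>))" by simp
    have "(\<beta> / s) * (1 - (real J + 1) * (1/2) ^ J) \<le> \<beta> / s"
      using \<open>0 < s\<close> \<open>0 < \<beta>\<close> mult_left_mono[of "1 - (real J + 1) * (1/2) ^ J" 1 "\<beta> / s"] by simp
    moreover have "(Phi (t / s) - \<delta>) * (1 / 4 - (1/2) ^ (J + 1)) \<ge> Phi (t / s) / 4 - \<delta> / 4 - (1/2) ^ (J + 1)"
    proof -
      define q where "q = (1/2::real) ^ (J + 1)"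
      have "0 \<le> q" by (simp add: q_def)
      then have "Phi (t / s) * q \<le> 1 * q" "0 \<le> \<delta> * q"
        using std_normal.cdf_bounded_prob \<delta> by (intro mult_right_mono mult_nonneg_nonneg; simp)+
      moreover have "(Phi (t / s) - \<delta>) * (1 / 4 - q) = Phi (t / s) / 4 - \<delta> / 4 - Phi (t / s) * q + \<delta> * q"
        by (simp add: algebra_simps)
      ultimately show ?thesis unfolding q_def[symmetric] by linarith
    qed
    ultimately have "Phi (t / s) / 4 - \<delta> / 4 - (1/2) ^ (J + 1) - \<beta> / s
      \<le> (\<Sum>j=2..J. c j * P (t + 2 * \<beta> - 2 * real j * \<beta>))"
      by (intro order_trans[OF diff_mono low])
    moreover have "3 * \<beta> / s = 2 * \<beta> / s + \<beta> / s" by (simp flip: add_divide_distrib)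
    ultimately show ?thesis using main unfolding right_diff_distrib by linarith
  qed
  have "(\<lambda>J. \<epsilon> + \<delta> / 4 + 3 * \<beta> / s + x + (1/2) ^ (J + 1)) \<longlonglongrightarrow> \<epsilon> + \<delta> / 4 + 3 * \<beta> / s + x + 0"
    by (intro tendsto_intros LIMSEQ_Suc[OF LIMSEQ_realpow_zero[of "1/2"], unfolded Suc_eq_plus1]) auto
  moreover have "eventually (\<lambda>J. 3 / 4 * (P t - Phi (t / s)) \<le> \<epsilon> + \<delta> / 4 + 3 * \<beta> / s + x + (1/2) ^ (J + 1)) sequentially"
    using eventually_ge_at_top[of "1::nat"] by eventually_elim (rule approx)
  ultimately have "3 / 4 * (P t - Phi (t / s)) \<le> \<epsilon> + \<delta> / 4 + 3 * \<beta> / s + x + 0"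
    by (intro tendsto_lowerbound) auto
  then show ?thesis by (simp add: P_def)
qed

text \<open>
  The lower bound on the distribution function is the upper bound for \<open>- S\<close>: the hypotheses
  are invariant under this reflection by \<open>\<Phi>(- u) = 1 - \<Phi>(u)\<close>.
\<close>

lemma smoothing:
  fixes S L :: "'a \<Rightarrow> real"
  assumes [measurable]: "S \<in> borel_measurable M" "L \<in> borel_measurable M" and "0 < s" "0 < \<beta>"
    and Lpos: "\<And>\<omega>. \<omega> \<in> space M \<Longrightarrow> 0 < L \<omega>"
    and Lx: "prob {\<omega> \<in> space M. \<beta>\<^sup>2 < L \<omega>} \<le> x"
    and heat_close: "\<And>t. \<bar>expectation (\<lambda>\<omega>. heat (t - S \<omega>) (L \<omega>)) - Phi (t / s)\<bar> \<le> \<epsilon>"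
    and close: "\<And>t. \<bar>prob {\<omega> \<in> space M. S \<omega> \<le> t} - Phi (t / s)\<bar> \<le> \<delta>"
  shows "3 / 4 * \<bar>prob {\<omega> \<in> space M. S \<omega> \<le> t} - Phi (t / s)\<bar> \<le> \<epsilon> + \<delta> / 4 + 3 * \<beta> / s + x"
proof -
  have up: "3 / 4 * (prob {\<omega> \<in> space M. S \<omega> \<le> t} - Phi (t / s)) \<le> \<epsilon> + \<delta> / 4 + 3 * \<beta> / s + x"
  proof (rule smoothing_one_sided[OF assms(1-6)])
    show "expectation (\<lambda>\<omega>. heat (t - S \<omega>) (L \<omega>)) \<le> Phi (t / s) + \<epsilon>" for t using heat_close[of t] by linarith
    show "0 \<le> \<delta>" using close[of 0] by linarith
    show "Phi (t / s) - \<delta> \<le> prob {\<omega> \<in> space M. S \<omega> \<le> t}" for t using close[of t] by linarith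
  qed
  have int: "integrable M (\<lambda>\<omega>. heat (t - S \<omega>) (L \<omega>))" for t
    by (rule integrable_bounded[of _ 1]) (simp_all add: heat_bounds)
  have lt: "prob {\<omega> \<in> space M. - S \<omega> \<le> u} = 1 - prob {\<omega> \<in> space M. S \<omega> < - u}" for u
    by (subst prob_compl[symmetric]) (auto intro!: arg_cong[of _ _ prob])
  have lt_le: "prob {\<omega> \<in> space M. S \<omega> < u} \<le> prob {\<omega> \<in> space M. S \<omega> \<le> u}" for u
    by (intro finite_measure_mono) auto
  have "3 / 4 * (prob {\<omega> \<in> space M. - S \<omega> \<le> - t} - Phi (- t / s)) \<le> \<epsilon> + \<delta> / 4 + 3 * \<beta> / s + x"
  proof (rule smoothing_one_sided[OF _ assms(2-6)])
    fix u
    have "expectation (\<lambda>\<omega>. heat (u - - S \<omega>) (L \<omega>)) = expectation (\<lambda>\<omega>. 1 - heat (- u - S \<omega>) (L \<omega>))"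
    proof (rule Bochner_Integration.integral_cong)
      fix \<omega>
      have "(u - - S \<omega>) / sqrt (L \<omega>) = - ((- u - S \<omega>) / sqrt (L \<omega>))"
        unfolding minus_divide_left by simp
      then show "heat (u - - S \<omega>) (L \<omega>) = 1 - heat (- u - S \<omega>) (L \<omega>)"
        by (simp only: heat_def Phi_uminus)
    qed simp
    also have "\<dots> = 1 - expectation (\<lambda>\<omega>. heat (- u - S \<omega>) (L \<omega>))" using int by (simp add: prob_space)
    also have "\<dots> \<le> 1 - (Phi (- u / s) - \<epsilon>)" using heat_close[of "- u"] by linarith
    also have "\<dots> = Phi (u / s) + \<epsilon>" using Phi_uminus[of "u / s"] by simp
    finally show "expectation (\<lambda>\<omega>. heat (u - - S \<omega>) (L \<omega>)) \<le> Phi (u / s) + \<epsilon>" .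
    show "Phi (u / s) - \<delta> \<le> prob {\<omega> \<in> space M. - S \<omega> \<le> u}"
      using close[of "- u"] lt_le[of "- u"] Phi_uminus[of "u / s"] unfolding lt by simp
  qed (use close[of 0] in simp_all)
  then have down: "3 / 4 * (Phi (t / s) - prob {\<omega> \<in> space M. S \<omega> \<le> t}) \<le> \<epsilon> + \<delta> / 4 + 3 * \<beta> / s + x"
    using lt_le[of t] Phi_uminus[of "t / s"] unfolding lt by simp
  show ?thesis using up down by (simp add: abs_if)
qed

end

section \<open>Martingales with nearly deterministic total conditional variance\<close>

text \<open>
  The self-bounding argument. With \<open>D\<close> the Kolmogorov distance, the bound on the expected
  potential and the smoothing lemma give \<open>3/4 D \<le> \<epsilon> + D/4 + 3 \<beta> / s + x\<close>, where
  \<open>\<epsilon>\<close> contains the term \<open>524288 \<gamma> \<sqdot> 8 D / k\<close>. The choice \<open>k = 2\<^sup>2\<^sup>5 \<gamma>\<close> makes this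
  term equal to \<open>D/8\<close>, so that a positive multiple of \<open>D\<close> remains on the left. The number \<open>J\<close>
  of dyadic scales is of the order of the logarithm of \<open>s / \<gamma>\<close>: then the largest scale
  \<open>2\<^sup>J k\<close> is at least \<open>s\<close>.
\<close>

lemma (in bounded_martingale) kolmogorov_distance_bound:
  fixes s x t :: real and J :: nat
  assumes s: "0 < s" "2 ^ 25 * \<gamma> \<le> s" and x: "0 \<le> x" and J: "s / \<gamma> \<le> 2 ^ J"
    and B: "B = s\<^sup>2 * (1 + x\<^sup>2)"
    and dev: "prob {\<omega> \<in> space M. (\<Sum>i=1..n. v i \<omega>) < s\<^sup>2 * (1 - x\<^sup>2)} \<le> x"
  shows "\<bar>prob {\<omega> \<in> space M. (\<Sum>i=1..n. Y i \<omega>) \<le> t} - Phi (t / s)\<bar>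
    \<le> 2 ^ 39 * (\<gamma> * (real J + 1) / s) + 16384 * x"
proof -
  define k where "k = 2 ^ 25 * \<gamma>"
  define S where "S \<omega> = (\<Sum>i=1..n. Y i \<omega>)" for \<omega>
  define L where "L \<omega> = B + k\<^sup>2 - (\<Sum>i=1..n. v i \<omega>)" for \<omega>
  define b where "b = sqrt (B + k\<^sup>2)"
  define dist where "dist t = \<bar>prob {\<omega> \<in> space M. S \<omega> \<le> t} - Phi (t / s)\<bar>" for t
  define D where "D = (SUP t. dist t)"
  have k: "0 < k" "512 * \<gamma> \<le> k" using \<gamma> by (simp_all add: k_def)
  have S_meas [measurable]: "S \<in> borel_measurable M"
    unfolding S_def[abs_def] using Y_measurable by (intro borel_measurable_sum) auto
  have L_meas [measurable]: "L \<in> borel_measurable M"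
    unfolding L_def[abs_def]
    by (intro borel_measurable_diff borel_measurable_sum borel_measurable_const
        measurable_from_subalg[OF subalg v_past]) auto
  have kL: "k\<^sup>2 \<le> L \<omega>" if "\<omega> \<in> space M" for \<omega>
    using total_variance[OF that] by (simp add: L_def)
  have dist_le: "dist t \<le> 1" for t
    using prob_le_1[of "{\<omega> \<in> space M. S \<omega> \<le> t}"] measure_nonneg[of M "{\<omega> \<in> space M. S \<omega> \<le> t}"]
      std_normal.cdf_bounded_prob[of "t / s"] std_normal.cdf_nonneg[of "t / s"]
    unfolding dist_def by linarith
  have dist_D: "dist t \<le> D" for t
    unfolding D_def by (rule cSUP_upper) (auto intro!: bdd_aboveI[of _ 1] dist_le)
  have close: "\<bar>prob {\<omega> \<in> space M. S \<omega> \<le> t} - Phi (t / s)\<bar> \<le> D" for t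
    using dist_D[of t] by (simp add: dist_def)
  have B0: "0 \<le> B" unfolding B by simp
  define R where "R = 524288 * \<gamma> * (6 * (real J + 1) / s + 8 * D / k + 1 / (2 ^ J * k))"
  define \<epsilon> where "\<epsilon> = R + 4096 * (x + k / s)"
  have heat_close: "\<bar>expectation (\<lambda>\<omega>. heat (t - S \<omega>) (L \<omega>)) - Phi (t / s)\<bar> \<le> \<epsilon>" for t
  proof -
    have "\<bar>expectation (\<lambda>\<omega>. heat (t - S \<omega>) (L \<omega>)) - Phi (t / b)\<bar>
      \<le> 524288 * \<gamma> * expectation (\<lambda>\<omega>. potential (t - S \<omega>) (L \<omega>))"
      using heat_le_potential[OF k(2) B0, of t] by (simp add: S_def L_def b_def)
    also have "\<dots> \<le> R"
      unfolding R_def using expectation_potential_le[OF S_meas s(1) k(1) kL close] \<gamma> by (intro mult_left_mono) auto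
    finally have 1: "\<bar>expectation (\<lambda>\<omega>. heat (t - S \<omega>) (L \<omega>)) - Phi (t / b)\<bar> \<le> R" .
    \<comment> \<open>The completed sum has variance \<open>b\<^sup>2\<close> instead of \<open>s\<^sup>2\<close>, with \<open>b \<le> s (1 + x) + k\<close>.\<close>
    have sb: "s \<le> b" unfolding b_def B using s(1) by (intro real_le_rsqrt) (simp add: distrib_left)
    have "b \<le> s + x * s + k"
    proof -
      have "B + k\<^sup>2 \<le> (s + x * s + k)\<^sup>2"
        using s(1) x k(1) by (simp add: B power2_eq_square algebra_simps)
      then show ?thesis unfolding b_def using s(1) x k(1) by (intro real_le_lsqrt) auto
    qed
    then have "b / s \<le> (s + x * s + k) / s" using s(1) by (intro divide_right_mono) auto
    then have bs: "b / s - 1 \<le> x + k / s" using s(1) by (simp add: add_divide_distrib)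
    have "t / s = b / s * (t / b)" using s(1) sb by simp
    then have "\<bar>Phi (t / s) - Phi (t / b)\<bar> \<le> 4096 * (b / s - 1)"
      using Phi_scale[of "b / s" "t / b"] s(1) sb by simp
    also have "\<dots> \<le> 4096 * (x + k / s)" using bs by (rule mult_left_mono) simp
    finally show ?thesis using 1 unfolding \<epsilon>_def by linarith
  qed
  \<comment> \<open>If the total conditional variance is at least \<open>s\<^sup>2 (1 - x\<^sup>2)\<close>, then \<open>L \<le> k\<^sup>2 + 2 x\<^sup>2 s\<^sup>2 \<le> \<beta>\<^sup>2\<close>.\<close>
  define \<beta> where "\<beta> = k + 2 * x * s"
  have \<beta>: "0 < \<beta>" using k s x by (simp add: \<beta>_def add_pos_nonneg)
  have "prob {\<omega> \<in> space M. \<beta>\<^sup>2 < L \<omega>} \<le> prob {\<omega> \<in> space M. (\<Sum>i=1..n. v i \<omega>) < s\<^sup>2 * (1 - x\<^sup>2)}"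
  proof (rule finite_measure_mono)
    have "k\<^sup>2 + 2 * (s\<^sup>2 * x\<^sup>2) \<le> \<beta>\<^sup>2"
      using k x s by (simp add: \<beta>_def power2_eq_square algebra_simps)
    then show "{\<omega> \<in> space M. \<beta>\<^sup>2 < L \<omega>} \<subseteq> {\<omega> \<in> space M. (\<Sum>i=1..n. v i \<omega>) < s\<^sup>2 * (1 - x\<^sup>2)}"
      by (auto simp: L_def B algebra_simps)
    have [measurable]: "(\<lambda>\<omega>. \<Sum>i=1..n. v i \<omega>) \<in> borel_measurable M"
      by (intro borel_measurable_sum measurable_from_subalg[OF subalg v_past]) auto
    show "{\<omega> \<in> space M. (\<Sum>i=1..n. v i \<omega>) < s\<^sup>2 * (1 - x\<^sup>2)} \<in> events" by measurable
  qed
  then have bad: "prob {\<omega> \<in> space M. \<beta>\<^sup>2 < L \<omega>} \<le> x" using dev by linarith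
  have Lpos: "0 < L \<omega>" if "\<omega> \<in> space M" for \<omega>
    using kL[OF that] zero_less_power[OF k(1), of 2] by linarith
  define q g w where "q = \<gamma> * (real J + 1) / s" and "g = \<gamma> / s" and "w = 1 / 64 / (2::real) ^ J"
  have "dist t \<le> 4 / 3 * (\<epsilon> + D / 4 + 3 * \<beta> / s + x)" for t
    using smoothing[OF S_meas L_meas s(1) \<beta> Lpos bad heat_close close, of t] by (simp add: dist_def)
  then have "D \<le> 4 / 3 * (\<epsilon> + D / 4 + 3 * \<beta> / s + x)" unfolding D_def by (intro cSUP_least) auto
  moreover have "3 * \<beta> / s = 3 * (k / s) + 6 * x" using s(1) by (simp add: \<beta>_def field_simps)
  ultimately have "D \<le> 4 / 3 * (\<epsilon> + D / 4 + (3 * (k / s) + 6 * x) + x)" by simp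
  moreover have kg: "k / s = 33554432 * g" by (simp add: k_def g_def)
  have "\<epsilon> = 3145728 * q + D / 8 + w + 4096 * x + 4096 * (k / s)"
    using \<gamma> by (simp add: \<epsilon>_def R_def k_def q_def w_def field_simps)
  moreover have "w \<le> g"
  proof -
    have "1 / 2 ^ J \<le> g" using J \<gamma> s(1) by (simp add: g_def field_simps)
    moreover have "w \<le> (1::real) / 2 ^ J" unfolding w_def by (intro divide_right_mono) auto
    ultimately show ?thesis by linarith
  qed
  moreover have "g \<le> q" unfolding q_def g_def using \<gamma> s(1) by (intro divide_right_mono) auto
  moreover have "0 \<le> g" using \<gamma> s(1) by (simp add: g_def)
  ultimately have "D \<le> 549755813888 * q + 16384 * x" using x unfolding kg by (simp add: field_simps)
  moreover have "(2::real) ^ 39 = 549755813888" by simp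
  ultimately have "D \<le> 2 ^ 39 * (\<gamma> * (real J + 1) / s) + 16384 * x" by (simp only: q_def)
  then show ?thesis using dist_D[of t] by (simp add: dist_def S_def)
qed

section \<open>Martingale difference sequences: clipping and stopping\<close>

lemma space_gen_sigma [simp]: "space (gen_sigma M X i) = space M"
  by (simp add: gen_sigma_def space_measure_of_conv)

lemma sets_gen_sigma:
  "sets (gen_sigma M X i) = sigma_sets (space M) {X j -` A \<inter> space M | j A. j \<in> {1..i} \<and> A \<in> sets borel}"
  unfolding gen_sigma_def by (rule sets_measure_of) auto

lemma measurable_gen_sigma: "j \<in> {1..i} \<Longrightarrow> X j \<in> borel_measurable (gen_sigma M X i)"
  by (rule measurableI) (auto simp: sets_gen_sigma)

lemma subalgebra_gen_sigma:
  assumes "\<And>j. j \<in> {1..i} \<Longrightarrow> X j \<in> borel_measurable M"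
  shows "subalgebra M (gen_sigma M X i)"
  unfolding subalgebra_def sets_gen_sigma
  using assms by (auto intro!: sets.sigma_sets_subset measurable_sets)

lemma subalgebra_gen_sigma_mono: "i \<le> k \<Longrightarrow> subalgebra (gen_sigma M X k) (gen_sigma M X i)"
proof -
  assume "i \<le> k"
  then have "{1..i} \<subseteq> {1..k}" by simp
  then show ?thesis
    unfolding subalgebra_def sets_gen_sigma by (intro conjI sigma_sets_mono') (simp, blast)
qed

lemma (in prob_space) sigma_finite_subalgebra_of_subalgebra:
  "subalgebra M F \<Longrightarrow> sigma_finite_subalgebra M F"
  by (intro finite_measure_subalgebra_is_sigma_finite finite_measure_subalgebra.intro
      finite_measure_subalgebra_axioms.intro finite_measure_axioms)

lemma AE_bound_of_seq_Linf_norm: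
  assumes "seq_Linf_norm M n X \<le> ereal \<gamma>" "i \<in> {1..n}"
  shows "AE \<omega> in M. \<bar>X i \<omega>\<bar> \<le> \<gamma>"
proof -
  have "Linf_norm M (X i) \<le> seq_Linf_norm M n X"
    unfolding seq_Linf_norm_def using assms(2) by (intro Max_ge) auto
  then have "Linf_norm M (X i) \<le> ereal \<gamma>" using assms(1) by simp
  moreover have "AE \<omega> in M. ereal \<bar>X i \<omega>\<bar> \<le> Linf_norm M (X i)"
    unfolding Linf_norm_def by (rule esssup_AE)
  ultimately show ?thesis by (auto elim!: eventually_mono dest: order_trans)
qed

text \<open>
  The stopping decision for the summand \<open>u i\<close> looks at the partial sum including \<open>u i\<close>
  itself, so the stopped sum never exceeds the level \<open>B\<close>. As the conditional variances are
  predictable, this decision is known before step \<open>i\<close>.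
\<close>

lemma stopped_sum_le:
  fixes u :: "nat \<Rightarrow> real"
  assumes "0 \<le> B" "\<And>i. i \<in> {1..n} \<Longrightarrow> 0 \<le> u i"
  shows "(\<Sum>i=1..n. if (\<Sum>j=1..i. u j) \<le> B then u i else 0) \<le> B"
  using assms(2)
proof (induction n)
  case (Suc n)
  have IH: "(\<Sum>i=1..n. if (\<Sum>j=1..i. u j) \<le> B then u i else 0) \<le> B" using Suc by simp
  show ?case
  proof (cases "(\<Sum>j=1..Suc n. u j) \<le> B")
    case True
    have "(\<Sum>i=1..n. if (\<Sum>j=1..i. u j) \<le> B then u i else 0) \<le> (\<Sum>i=1..n. u i)"
      using Suc.prems by (intro sum_mono) auto
    then show ?thesis using True by simp
  next
    case False
    then show ?thesis using IH by simp
  qed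
qed (use assms(1) in simp)

text \<open>
  Clipping \<open>X i\<close> to \<open>[-\<gamma>, \<gamma>]\<close> and its conditional variance to \<open>[0, \<gamma>\<^sup>2]\<close> changes both on
  null sets only and makes the bounds hold everywhere; stopping then makes the total
  conditional variance at most \<open>s\<^sup>2 (1 + x\<^sup>2)\<close>. Outside the event \<open>bad\<close> that
  \<open>\<bar>V\<^sup>2 - 1\<bar> \<ge> x\<^sup>2\<close> no stopping takes place. The exponent \<open>2 p + 1\<close> in the moment
  hypothesis is the one for which Markov's inequality yields
  \<open>P(bad) \<le> x\<^bsup>2p+1\<^esup> / x\<^bsup>2p\<^esup> = x\<close>.
\<close>

lemma D_dist_bound:
  fixes M :: "'a measure" and x \<gamma> :: real and J :: nat
  assumes X: "mart_diff M n X" and s: "0 < s_norm M n X" "2 ^ 25 * \<gamma> \<le> s_norm M n X" and \<gamma>: "0 < \<gamma>"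
    and bound: "seq_Linf_norm M n X \<le> ereal \<gamma>"
    and J: "s_norm M n X / \<gamma> \<le> 2 ^ J" and x: "0 < x" and p: "1 \<le> p"
    and moment: "(\<integral>\<omega>. \<bar>V2 M n X \<omega> - 1\<bar> powr p \<partial>M) \<le> x powr (2 * p + 1)"
  shows "D_dist M n X \<le> 2 ^ 39 * (\<gamma> * (real J + 1) / s_norm M n X) + 16385 * x"
proof -
  interpret prob_space M using X by (simp add: mart_diff_def)
  define s where "s = s_norm M n X"
  have s0: "0 < s" using s by (simp add: s_def)
  have s2: "s2 M n X = s\<^sup>2" using s0 by (simp add: s_def s_norm_def real_sqrt_gt_0_iff)
  define G where "G i = gen_sigma M X (i - 1)" for i
  define \<sigma> where "\<sigma> i = real_cond_exp M (G i) (\<lambda>\<omega>. (X i \<omega>)\<^sup>2)" for i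
  define u where "u i \<omega> = min (\<gamma>\<^sup>2) (max 0 (\<sigma> i \<omega>))" for i \<omega>
  define Z where "Z i \<omega> = max (- \<gamma>) (min \<gamma> (X i \<omega>))" for i \<omega>
  define B where "B = s\<^sup>2 * (1 + x\<^sup>2)"
  define Y where "Y i \<omega> = (if (\<Sum>j=1..i. u j \<omega>) \<le> B then Z i \<omega> else 0)" for i \<omega>
  define v where "v i \<omega> = (if (\<Sum>j=1..i. u j \<omega>) \<le> B then u i \<omega> else 0)" for i \<omega>
  have X_meas: "X i \<in> borel_measurable M" and X_sq: "integrable M (\<lambda>\<omega>. (X i \<omega>)\<^sup>2)"
    and X_centred: "AE \<omega> in M. real_cond_exp M (G i) (X i) \<omega> = 0" if "i \<in> {1..n}" for i
    using X that by (auto simp: mart_diff_def G_def)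
  have sub: "subalgebra M (G i)" if "i \<in> {1..n}" for i
    unfolding G_def using that X_meas by (intro subalgebra_gen_sigma) auto
  have sub_mono: "subalgebra (G k) (G i)" if "i \<le> k" for i k
    unfolding G_def using that by (intro subalgebra_gen_sigma_mono) auto
  have X_bound: "AE \<omega> in M. \<bar>X i \<omega>\<bar> \<le> \<gamma>" if "i \<in> {1..n}" for i
    using AE_bound_of_seq_Linf_norm[OF bound that] .
  have X_int: "integrable M (X i)" if "i \<in> {1..n}" for i
    using X_meas[OF that] X_bound[OF that] by (intro integrable_const_bound[of _ \<gamma>]) auto
  have \<sigma>_bounds: "AE \<omega> in M. 0 \<le> \<sigma> i \<omega> \<and> \<sigma> i \<omega> \<le> \<gamma>\<^sup>2" if i: "i \<in> {1..n}" for i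
  proof -
    interpret sigma_finite_subalgebra M "G i" by (rule sigma_finite_subalgebra_of_subalgebra[OF sub[OF i]])
    have "AE \<omega> in M. (X i \<omega>)\<^sup>2 \<le> \<gamma>\<^sup>2"
      using X_bound[OF i] by eventually_elim (metis abs_ge_zero power2_abs power_mono)
    then have "AE \<omega> in M. \<sigma> i \<omega> \<le> \<gamma>\<^sup>2" unfolding \<sigma>_def using X_sq[OF i] by (intro real_cond_exp_le_c)
    moreover have "AE \<omega> in M. 0 \<le> \<sigma> i \<omega>"
      unfolding \<sigma>_def using X_sq[OF i] by (intro real_cond_exp_ge_c) auto
    ultimately show ?thesis by eventually_elim simp
  qed
  have u_eq: "AE \<omega> in M. u i \<omega> = \<sigma> i \<omega>" if "i \<in> {1..n}" for i
    using \<sigma>_bounds[OF that] by eventually_elim (auto simp: u_def)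
  have Z_eq: "AE \<omega> in M. Z i \<omega> = X i \<omega>" if "i \<in> {1..n}" for i
    using X_bound[OF that] by eventually_elim (auto simp: Z_def abs_le_iff)
  have u_bounds: "0 \<le> u i \<omega>" "u i \<omega> \<le> \<gamma>\<^sup>2" for i \<omega> by (auto simp: u_def)
  have u_past: "u j \<in> borel_measurable (G i)" if "j \<le> i" for i j
  proof (rule measurable_from_subalg[OF sub_mono[OF that]])
    show "u j \<in> borel_measurable (G j)"
      unfolding u_def[abs_def] \<sigma>_def by (intro borel_measurable_min borel_measurable_max) auto
  qed
  have stop_meas: "{\<omega> \<in> space (G i). (\<Sum>j=1..k. u j \<omega>) \<le> B} \<in> sets (G i)" if "k \<le> i" for k i
  proof -
    have "(\<lambda>\<omega>. \<Sum>j=1..k. u j \<omega>) \<in> borel_measurable (G i)"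
      using that by (intro borel_measurable_sum u_past) auto
    then show ?thesis by measurable
  qed
  have Z_past: "Z j \<in> borel_measurable (G i)" if "j \<in> {1..<i}" for i j
    unfolding Z_def[abs_def] G_def using that
    by (intro borel_measurable_min borel_measurable_max measurable_gen_sigma borel_measurable_const) auto
  have Z_meas: "Z i \<in> borel_measurable M" if "i \<in> {1..n}" for i
    unfolding Z_def[abs_def] using X_meas[OF that] by measurable
  have stop_meas': "{\<omega> \<in> space M. (\<Sum>j=1..i. u j \<omega>) \<le> B} \<in> events" if "i \<in> {1..n}" for i
    using stop_meas[OF order_refl, of i] sub[OF that] by (auto simp: subalgebra_def G_def)
  have indic: "(\<lambda>\<omega>. g \<omega> * (if (\<Sum>j=1..i. u j \<omega>) \<le> B then 1 else 0)) \<in> borel_measurable (G i)"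
    if "g \<in> borel_measurable (G i)" for g :: "'a \<Rightarrow> real" and i
    using that by (intro borel_measurable_times measurable_If stop_meas) auto
  interpret Y: bounded_martingale M G Y v n \<gamma> B
  proof
    fix i assume i: "i \<in> {1..n}"
    interpret sigma_finite_subalgebra M "G i" by (rule sigma_finite_subalgebra_of_subalgebra[OF sub[OF i]])
    show "subalgebra M (G i)" by (rule sub[OF i])
    show "Y i \<in> borel_measurable M"
      unfolding Y_def[abs_def] by (intro measurable_If Z_meas[OF i] stop_meas'[OF i] borel_measurable_const)
    show "Y j \<in> borel_measurable (G i)" if "j \<in> {1..<i}" for j
      unfolding Y_def[abs_def] using that by (intro measurable_If Z_past stop_meas borel_measurable_const) auto
    show "v j \<in> borel_measurable (G i)" if "j \<in> {1..i}" for j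
      unfolding v_def[abs_def] using that by (intro measurable_If u_past stop_meas borel_measurable_const) auto
    show "\<bar>Y i \<omega>\<bar> \<le> \<gamma>" for \<omega> using \<gamma> by (auto simp: Y_def Z_def)
    show "0 \<le> v i \<omega> \<and> v i \<omega> \<le> \<gamma>\<^sup>2" for \<omega> using u_bounds by (auto simp: v_def)
    fix g :: "'a \<Rightarrow> real" and C
    assume g: "g \<in> borel_measurable (G i)" and gC: "\<And>\<omega>. \<omega> \<in> space M \<Longrightarrow> \<bar>g \<omega>\<bar> \<le> C"
    define h where "h \<omega> = g \<omega> * (if (\<Sum>j=1..i. u j \<omega>) \<le> B then 1 else 0)" for \<omega>
    have h: "h \<in> borel_measurable (G i)" unfolding h_def[abs_def] by (rule indic[OF g])
    have hM: "h \<in> borel_measurable M" by (rule measurable_from_subalg[OF sub[OF i] h])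
    have hC: "AE \<omega> in M. norm (h \<omega>) \<le> C"
    proof (rule AE_I2)
      fix \<omega> assume "\<omega> \<in> space M"
      with gC[OF this] show "norm (h \<omega>) \<le> C" by (auto simp: h_def)
    qed
    have int: "integrable M (\<lambda>\<omega>. h \<omega> * f \<omega>)" if "integrable M f" for f :: "'a \<Rightarrow> real"
    proof (rule Bochner_Integration.integrable_bound)
      show "integrable M (\<lambda>\<omega>. C * f \<omega>)" using that by simp
      show "(\<lambda>\<omega>. h \<omega> * f \<omega>) \<in> borel_measurable M" using hM that by measurable
      show "AE \<omega> in M. norm (h \<omega> * f \<omega>) \<le> norm (C * f \<omega>)"
        using hC by eventually_elim (auto simp: abs_mult intro!: mult_right_mono)
    qed
    have "expectation (\<lambda>\<omega>. g \<omega> * Y i \<omega>) = expectation (\<lambda>\<omega>. h \<omega> * X i \<omega>)"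
    proof (rule integral_cong_AE)
      show "AE \<omega> in M. g \<omega> * Y i \<omega> = h \<omega> * X i \<omega>"
        using Z_eq[OF i] by eventually_elim (simp add: Y_def h_def)
    qed (use hM X_meas[OF i] \<open>Y i \<in> borel_measurable M\<close> measurable_from_subalg[OF sub[OF i] g] in measurable)
    also have "\<dots> = expectation (\<lambda>\<omega>. h \<omega> * real_cond_exp M (G i) (X i) \<omega>)"
      by (rule real_cond_exp_intg(2)[symmetric, OF int[OF X_int[OF i]] h X_meas[OF i]])
    also have "\<dots> = expectation (\<lambda>\<omega>. 0)"
    proof (rule integral_cong_AE)
      show "AE \<omega> in M. h \<omega> * real_cond_exp M (G i) (X i) \<omega> = 0"
        using X_centred[OF i] by eventually_elim simp
    qed (use hM in measurable)
    finally show "expectation (\<lambda>\<omega>. g \<omega> * Y i \<omega>) = 0" by simp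
    have "expectation (\<lambda>\<omega>. g \<omega> * (Y i \<omega>)\<^sup>2) = expectation (\<lambda>\<omega>. h \<omega> * (X i \<omega>)\<^sup>2)"
    proof (rule integral_cong_AE)
      show "AE \<omega> in M. g \<omega> * (Y i \<omega>)\<^sup>2 = h \<omega> * (X i \<omega>)\<^sup>2"
        using Z_eq[OF i] by eventually_elim (simp add: Y_def h_def)
    qed (use hM X_meas[OF i] \<open>Y i \<in> borel_measurable M\<close> measurable_from_subalg[OF sub[OF i] g] in measurable)
    also have "\<dots> = expectation (\<lambda>\<omega>. h \<omega> * \<sigma> i \<omega>)"
      unfolding \<sigma>_def
      by (rule real_cond_exp_intg(2)[symmetric, OF int[OF X_sq[OF i]] h]) (use X_meas[OF i] in measurable)
    also have "\<dots> = expectation (\<lambda>\<omega>. g \<omega> * v i \<omega>)"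
    proof (rule integral_cong_AE)
      show "AE \<omega> in M. h \<omega> * \<sigma> i \<omega> = g \<omega> * v i \<omega>"
        using u_eq[OF i] by eventually_elim (simp add: v_def h_def)
      have "v i \<in> borel_measurable M"
        using measurable_from_subalg[OF sub[OF i] \<open>\<And>j. j \<in> {1..i} \<Longrightarrow> v j \<in> borel_measurable (G i)\<close>[of i]] i by auto
      then show "(\<lambda>\<omega>. g \<omega> * v i \<omega>) \<in> borel_measurable M"
        using measurable_from_subalg[OF sub[OF i] g] by measurable
      show "(\<lambda>\<omega>. h \<omega> * \<sigma> i \<omega>) \<in> borel_measurable M" unfolding \<sigma>_def using hM by measurable
    qed
    finally show "expectation (\<lambda>\<omega>. g \<omega> * (Y i \<omega>)\<^sup>2) = expectation (\<lambda>\<omega>. g \<omega> * v i \<omega>)" .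
  next
    show "0 < \<gamma>" by (rule \<gamma>)
    show "(\<Sum>i=1..n. v i \<omega>) \<le> B" for \<omega>
      unfolding v_def using u_bounds s0 by (intro stopped_sum_le) (auto simp: B_def)
  qed
  have u_meas: "u i \<in> borel_measurable M" if "i \<in> {1..n}" for i
    by (rule measurable_from_subalg[OF sub[OF that] u_past[OF order_refl]])
  define W where "W \<omega> = (\<Sum>i=1..n. u i \<omega>) / s\<^sup>2" for \<omega>
  have W_meas [measurable]: "W \<in> borel_measurable M"
    unfolding W_def[abs_def] by (intro borel_measurable_divide borel_measurable_sum borel_measurable_const u_meas) auto
  have "AE \<omega> in M. \<forall>i\<in>{1..n}. u i \<omega> = \<sigma> i \<omega> \<and> Z i \<omega> = X i \<omega>"
    using u_eq Z_eq by (intro AE_finite_allI) (auto elim!: eventually_elim2)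
  note all_eq = this
  have W_eq: "AE \<omega> in M. W \<omega> = V2 M n X \<omega>"
    using all_eq by eventually_elim (simp add: W_def V2_def s2 \<sigma>_def G_def)
  define bad where "bad = {\<omega> \<in> space M. (x\<^sup>2) powr p \<le> \<bar>W \<omega> - 1\<bar> powr p}"
  have bad_meas [measurable]: "bad \<in> events" unfolding bad_def by measurable
  have bad_le: "prob bad \<le> x"
  proof -
    have "integrable M (\<lambda>\<omega>. \<bar>W \<omega> - 1\<bar> powr p)"
    proof (rule integrable_bounded)
      fix \<omega>
      have "0 \<le> W \<omega>" unfolding W_def using u_bounds by (intro divide_nonneg_nonneg sum_nonneg) auto
      moreover have "W \<omega> \<le> (\<Sum>i=1..n. \<gamma>\<^sup>2) / s\<^sup>2"
        unfolding W_def using u_bounds by (intro divide_right_mono sum_mono) auto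
      ultimately have "\<bar>W \<omega> - 1\<bar> \<le> 1 + (\<Sum>i=1..n. \<gamma>\<^sup>2) / s\<^sup>2" by linarith
      then show "\<bar>\<bar>W \<omega> - 1\<bar> powr p\<bar> \<le> (1 + (\<Sum>i=1..n. \<gamma>\<^sup>2) / s\<^sup>2) powr p"
        using p by (simp add: powr_mono2)
    qed measurable
    then have "prob bad \<le> expectation (\<lambda>\<omega>. \<bar>W \<omega> - 1\<bar> powr p) / (x\<^sup>2) powr p"
      unfolding bad_def using x by (intro integral_Markov_inequality_measure[of _ _ "{}"]) auto
    also have "expectation (\<lambda>\<omega>. \<bar>W \<omega> - 1\<bar> powr p) = expectation (\<lambda>\<omega>. \<bar>V2 M n X \<omega> - 1\<bar> powr p)"
    proof (rule integral_cong_AE)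
      show "AE \<omega> in M. \<bar>W \<omega> - 1\<bar> powr p = \<bar>V2 M n X \<omega> - 1\<bar> powr p"
        using W_eq by eventually_elim simp
      have "V2 M n X \<in> borel_measurable M" unfolding V2_def[abs_def] by measurable
      then show "(\<lambda>\<omega>. \<bar>V2 M n X \<omega> - 1\<bar> powr p) \<in> borel_measurable M" by measurable
    qed measurable
    also have "\<dots> / (x\<^sup>2) powr p \<le> x powr (2 * p + 1) / (x\<^sup>2) powr p"
      using moment by (intro divide_right_mono) auto
    also have "(x\<^sup>2) powr p = x powr (2 * p)" using x by (simp add: powr_powr flip: powr_numeral)
    also have "x powr (2 * p + 1) / x powr (2 * p) = x" using x by (simp flip: powr_diff)
    finally show ?thesis .
  qed
  have good: "\<bar>W \<omega> - 1\<bar> < x\<^sup>2" if "\<omega> \<in> space M" "\<omega> \<notin> bad" for \<omega>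
  proof (rule ccontr)
    assume "\<not> \<bar>W \<omega> - 1\<bar> < x\<^sup>2"
    then have "(x\<^sup>2) powr p \<le> \<bar>W \<omega> - 1\<bar> powr p" using p by (intro powr_mono2) auto
    then show False using that by (simp add: bad_def)
  qed
  have unstopped: "Y i \<omega> = Z i \<omega>" "v i \<omega> = u i \<omega>"
    if "\<omega> \<in> space M" "\<omega> \<notin> bad" "i \<in> {1..n}" for i \<omega>
  proof -
    have "(\<Sum>j=1..i. u j \<omega>) \<le> (\<Sum>j=1..n. u j \<omega>)" using that u_bounds by (intro sum_mono2) auto
    also have "\<dots> = W \<omega> * s\<^sup>2" using s0 by (simp add: W_def)
    also have "\<dots> \<le> (1 + x\<^sup>2) * s\<^sup>2" using good[OF that(1,2)] by (intro mult_right_mono) auto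
    finally have "(\<Sum>j=1..i. u j \<omega>) \<le> B" by (simp add: B_def mult.commute)
    then show "Y i \<omega> = Z i \<omega>" "v i \<omega> = u i \<omega>" by (auto simp: Y_def v_def)
  qed
  have dev: "prob {\<omega> \<in> space M. (\<Sum>i=1..n. v i \<omega>) < s\<^sup>2 * (1 - x\<^sup>2)} \<le> x"
  proof (rule order_trans[OF finite_measure_mono[OF _ bad_meas] bad_le], rule subsetI)
    fix \<omega> assume w: "\<omega> \<in> {\<omega> \<in> space M. (\<Sum>i=1..n. v i \<omega>) < s\<^sup>2 * (1 - x\<^sup>2)}"
    show "\<omega> \<in> bad"
    proof (rule ccontr)
      assume nb: "\<omega> \<notin> bad"
      have "(\<Sum>i=1..n. v i \<omega>) = (\<Sum>i=1..n. u i \<omega>)" using unstopped(2) w nb by (intro sum.cong) auto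
      also have "\<dots> = s\<^sup>2 * W \<omega>" using s0 by (simp add: W_def)
      also have "\<dots> \<ge> s\<^sup>2 * (1 - x\<^sup>2)" using good[of \<omega>] w nb by (intro mult_left_mono) auto
      finally show False using w by simp
    qed
  qed
  have Y_meas [measurable]: "(\<lambda>\<omega>. \<Sum>i=1..n. Y i \<omega>) \<in> borel_measurable M"
    using Y.Y_measurable by (intro borel_measurable_sum) auto
  have S_meas [measurable]: "S_sum n X \<in> borel_measurable M"
    unfolding S_sum_def[abs_def] using X_meas by (intro borel_measurable_sum) auto
  have "\<bar>prob {\<omega> \<in> space M. S_sum n X \<omega> / s \<le> t} - Phi t\<bar>
    \<le> 2 ^ 39 * (\<gamma> * (real J + 1) / s) + 16385 * x" for t
  proof -
    let ?A = "{\<omega> \<in> space M. S_sum n X \<omega> / s \<le> t}" and ?B = "{\<omega> \<in> space M. (\<Sum>i=1..n. Y i \<omega>) \<le> t * s}"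
    have A_meas: "?A \<in> events" and B_meas: "?B \<in> events" by measurable
    have "AE \<omega> in M. \<omega> \<notin> bad \<longrightarrow> (\<omega> \<in> ?A \<longleftrightarrow> \<omega> \<in> ?B)"
      using all_eq AE_space
    proof eventually_elim
      case (elim \<omega>)
      show ?case
      proof
        assume nb: "\<omega> \<notin> bad"
        have "(\<Sum>i=1..n. Y i \<omega>) = S_sum n X \<omega>"
          unfolding S_sum_def using elim unstopped(1)[OF _ nb] by (intro sum.cong) auto
        then show "\<omega> \<in> ?A \<longleftrightarrow> \<omega> \<in> ?B" using s0 elim by (simp add: pos_divide_le_eq)
      qed
    qed
    note ae = this
    have "prob ?A \<le> prob (?B \<union> bad)"
      using ae B_meas bad_meas by (intro finite_measure_mono_AE) (auto elim!: eventually_mono)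
    moreover have "prob ?B \<le> prob (?A \<union> bad)"
      using ae A_meas bad_meas by (intro finite_measure_mono_AE) (auto elim!: eventually_mono)
    moreover have "prob (?B \<union> bad) \<le> prob ?B + prob bad" "prob (?A \<union> bad) \<le> prob ?A + prob bad"
      using A_meas B_meas bad_meas by (auto intro!: measure_Un_le)
    moreover have "\<bar>prob ?B - Phi (t * s / s)\<bar> \<le> 2 ^ 39 * (\<gamma> * (real J + 1) / s) + 16384 * x"
      using s J x by (intro Y.kolmogorov_distance_bound[OF s0 _ _ _ B_def dev]) (auto simp: s_def)
    moreover have "t * s / s = t" using s0 by simp
    ultimately show ?thesis using bad_le by (simp only:)
  qed
  then show ?thesis unfolding D_dist_def s_def by (intro cSUP_least) auto
qed

section \<open>Image measures: passing to the space of real sequences\<close>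

text \<open>
  Conditional expectation commutes with passing to an image measure, when the conditioning
  sigma-algebra is the pull-back of one on the image space: the pulled-back conditional
  expectation is measurable and has the right integrals over pulled-back sets.
\<close>

lemma (in prob_space) real_cond_exp_distr:
  assumes T: "T \<in> measurable M N" and F': "subalgebra (distr M N T) F'"
    and F: "subalgebra M F" and sets_F: "sets F = {T -` A \<inter> space M | A. A \<in> sets F'}"
    and f: "integrable (distr M N T) f"
  shows "AE \<omega> in M. real_cond_exp M F (\<lambda>\<omega>. f (T \<omega>)) \<omega> = real_cond_exp (distr M N T) F' f (T \<omega>)"
proof -
  interpret N: prob_space "distr M N T" by (rule prob_space_distr[OF T])
  interpret N: sigma_finite_subalgebra "distr M N T" F' by (rule N.sigma_finite_subalgebra_of_subalgebra[OF F'])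
  interpret sigma_finite_subalgebra M F by (rule sigma_finite_subalgebra_of_subalgebra[OF F])
  let ?c = "real_cond_exp (distr M N T) F' f"
  have [measurable]: "f \<in> borel_measurable N" using borel_measurable_integrable[OF f] by simp
  have c_meas: "?c \<in> borel_measurable F'" by simp
  have c_int: "integrable (distr M N T) ?c" using f by (rule N.real_cond_exp_int)
  have cN [measurable]: "?c \<in> borel_measurable N" using measurable_from_subalg[OF F' c_meas] by simp
  have space_F': "space F' = space N" using F' by (simp add: subalgebra_def)
  have TF: "T \<in> measurable F F'"
  proof (rule measurableI)
    fix \<omega> assume "\<omega> \<in> space F"
    then show "T \<omega> \<in> space F'" using F measurable_space[OF T] by (simp add: subalgebra_def space_F')
  next
    fix A assume "A \<in> sets F'"
    then show "T -` A \<inter> space F \<in> sets F" using F by (auto simp: sets_F subalgebra_def)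
  qed
  show ?thesis
  proof (rule real_cond_exp_charact)
    fix A assume "A \<in> sets F"
    then obtain A' where A': "A' \<in> sets F'" "A = T -` A' \<inter> space M" by (auto simp: sets_F)
    have [measurable]: "A' \<in> sets N" using A'(1) F' by (auto simp: subalgebra_def)
    have eq: "(\<integral>\<omega>\<in>A. g (T \<omega>) \<partial>M) = (\<integral>y\<in>A'. g y \<partial>distr M N T)" if "g \<in> borel_measurable N" for g :: "_ \<Rightarrow> real"
    proof -
      have "(\<integral>y\<in>A'. g y \<partial>distr M N T) = (\<integral>\<omega>. indicator A' (T \<omega>) *\<^sub>R g (T \<omega>) \<partial>M)"
        unfolding set_lebesgue_integral_def using that by (intro integral_distr[OF T]) measurable
      also have "\<dots> = (\<integral>\<omega>\<in>A. g (T \<omega>) \<partial>M)"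
        unfolding set_lebesgue_integral_def
        by (intro Bochner_Integration.integral_cong) (auto simp: A'(2) indicator_def)
      finally show ?thesis by simp
    qed
    show "(\<integral>\<omega>\<in>A. f (T \<omega>) \<partial>M) = (\<integral>\<omega>\<in>A. ?c (T \<omega>) \<partial>M)"
      using N.real_cond_exp_intA[OF f A'(1)] by (simp add: eq)
  next
    show "integrable M (\<lambda>\<omega>. f (T \<omega>))" using integrable_distr[OF T f] .
    show "integrable M (\<lambda>\<omega>. ?c (T \<omega>))" using integrable_distr[OF T c_int] .
    show "(\<lambda>\<omega>. ?c (T \<omega>)) \<in> borel_measurable F" by (rule measurable_compose[OF TF c_meas])
  qed
qed

lemma sets_gen_sigma_vimage:
  assumes T: "T \<in> space M \<rightarrow> space N" and X: "\<And>j \<omega>. j \<in> {1..k} \<Longrightarrow> \<omega> \<in> space M \<Longrightarrow> Y j (T \<omega>) = X j \<omega>"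
  shows "sets (gen_sigma M X k) = {T -` A \<inter> space M | A. A \<in> sets (gen_sigma N Y k)}"
proof -
  have "{X j -` A \<inter> space M | j A. j \<in> {1..k} \<and> A \<in> sets borel}
    = {T -` A \<inter> space M | A. A \<in> {Y j -` A \<inter> space N | j A. j \<in> {1..k} \<and> A \<in> sets borel}}" (is "?L = ?R")
  proof -
    have eq: "X j -` A \<inter> space M = T -` (Y j -` A \<inter> space N) \<inter> space M" if "j \<in> {1..k}" for j A
      using T X[OF that] by auto
    show ?thesis
    proof (intro equalityI subsetI)
      fix S assume "S \<in> ?L"
      then obtain j A where "j \<in> {1..k}" "A \<in> sets borel" "S = X j -` A \<inter> space M" by blast
      then show "S \<in> ?R" using eq[of j A] by blast
    next
      fix S assume "S \<in> ?R"
      then obtain j A where "j \<in> {1..k}" "A \<in> sets borel" "S = T -` (Y j -` A \<inter> space N) \<inter> space M" by blast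
      then show "S \<in> ?L" using eq[of j A] by (intro CollectI exI[of _ j] exI[of _ A]) simp
    qed
  qed
  then show ?thesis
    unfolding sets_gen_sigma by (simp only: sigma_sets_vimage_commute[OF T])
qed

text \<open>
  The values outside \<open>{1..n}\<close> are set to 0 because \<open>X i\<close> is known to be measurable for \<open>i\<close> in
  this range only.
\<close>

definition trajectory :: "nat \<Rightarrow> (nat \<Rightarrow> 'a \<Rightarrow> real) \<Rightarrow> 'a \<Rightarrow> nat \<Rightarrow> real" where
  "trajectory n X \<omega> i = (if i \<in> {1..n} then X i \<omega> else 0)"

text \<open>
  Under the law of the trajectory, the coordinate functions form a martingale difference
  sequence for which all quantities in the bound have the same values as for \<open>X\<close>.
\<close>

lemma rate_bound_transfer:
  assumes C: "rate_bound TYPE(nat \<Rightarrow> real) p \<gamma> C"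
  shows "rate_bound TYPE('a) p \<gamma> C"
  unfolding rate_bound_def
proof (intro allI impI)
  fix n :: nat and M :: "'a measure" and X
  assume n: "2 \<le> n" and X: "mart_diff M n X" and s: "0 < s_norm M n X"
    and bound: "seq_Linf_norm M n X \<le> ereal \<gamma>"
  interpret prob_space M using X by (simp add: mart_diff_def)
  let ?P = "Pi\<^sub>M UNIV (\<lambda>_. borel) :: (nat \<Rightarrow> real) measure"
  define T where "T = trajectory n X"
  define N where "N = distr M ?P T"
  define Y where "Y = (\<lambda>(i::nat) (f::nat \<Rightarrow> real). f i)"
  have X_meas: "X i \<in> borel_measurable M" and X_sq: "integrable M (\<lambda>\<omega>. (X i \<omega>)\<^sup>2)"
    and X_centred: "AE \<omega> in M. real_cond_exp M (gen_sigma M X (i - 1)) (X i) \<omega> = 0" if "i \<in> {1..n}" for i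
    using X that by (auto simp: mart_diff_def)
  have T: "T \<in> measurable M ?P"
  proof (rule measurable_PiM_single')
    fix i
    have "(\<lambda>\<omega>. T \<omega> i) = (if i \<in> {1..n} then X i else (\<lambda>_. 0))" by (auto simp: T_def trajectory_def)
    then show "(\<lambda>\<omega>. T \<omega> i) \<in> borel_measurable M" using X_meas[of i] by simp
  qed (auto simp: space_PiM)
  have space_N: "space N = UNIV" by (simp add: N_def space_PiM)
  have sets_N: "sets N = sets ?P" by (simp add: N_def)
  have Y_meas: "Y i \<in> borel_measurable ?P" for i unfolding Y_def by simp
  have Y_meas_N: "Y i \<in> borel_measurable N" for i using Y_meas[of i] by (simp add: N_def)
  have YT: "Y i (T \<omega>) = X i \<omega>" if "i \<in> {1..n}" for i \<omega> using that by (simp add: Y_def T_def trajectory_def)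
  interpret N: prob_space N unfolding N_def by (rule prob_space_distr[OF T])
  have sub_M: "subalgebra M (gen_sigma M X k)" if "k \<le> n" for k
    using that X_meas by (intro subalgebra_gen_sigma) auto
  have sub_N: "subalgebra N (gen_sigma N Y k)" for k
    using Y_meas_N by (intro subalgebra_gen_sigma) auto
  have cond_exp: "AE \<omega> in M. real_cond_exp M (gen_sigma M X k) (\<lambda>\<omega>. f (T \<omega>)) \<omega> = real_cond_exp N (gen_sigma N Y k) f (T \<omega>)"
    if "k \<le> n" "integrable N f" for k f
    unfolding N_def
  proof (rule real_cond_exp_distr[OF T])
    show "sets (gen_sigma M X k) = {T -` A \<inter> space M | A. A \<in> sets (gen_sigma (distr M ?P T) Y k)}"
      using that(1) YT by (intro sets_gen_sigma_vimage) (auto simp: space_PiM)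
  qed (use sub_M[OF that(1)] sub_N that(2) in \<open>simp_all add: N_def\<close>)
  have integral_N: "(\<integral>y. f y \<partial>N) = (\<integral>\<omega>. f (T \<omega>) \<partial>M)" if "f \<in> borel_measurable ?P" for f :: "_ \<Rightarrow> real"
    unfolding N_def using T that by (rule integral_distr)
  have integrable_N: "integrable N f \<longleftrightarrow> integrable M (\<lambda>\<omega>. f (T \<omega>))" if "f \<in> borel_measurable ?P" for f :: "_ \<Rightarrow> real"
    unfolding N_def using T that by (rule integrable_distr_eq)
  have AE_N: "(AE y in N. Q y) \<longleftrightarrow> (AE \<omega> in M. Q (T \<omega>))" if "{y \<in> space ?P. Q y} \<in> sets ?P" for Q
    unfolding N_def using T that by (rule AE_distr_iff)
  have ce_meas: "real_cond_exp N G f \<in> borel_measurable ?P" for G f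
    using borel_measurable_cond_exp2[of N G f] by (simp add: N_def)
  have Y_sq: "integrable N (\<lambda>y. (Y i y)\<^sup>2)" if "i \<in> {1..n}" for i
    using X_sq[OF that] YT[OF that] Y_meas[of i] by (subst integrable_N) auto
  have diff_le_n: "i - 1 \<le> n" if "i \<in> {1..n}" for i using that by auto
  have bound_X: "AE \<omega> in M. \<bar>X i \<omega>\<bar> \<le> \<gamma>" if "i \<in> {1..n}" for i
    by (rule AE_bound_of_seq_Linf_norm[OF bound that])
  have Y_int: "integrable N (Y i)" if "i \<in> {1..n}" for i
  proof (subst integrable_N[OF Y_meas])
    show "integrable M (\<lambda>\<omega>. Y i (T \<omega>))"
      using X_meas[OF that] bound_X[OF that] YT[OF that]
      by (intro integrable_const_bound[of _ \<gamma>]) auto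
  qed
  have mart: "mart_diff N n Y"
    unfolding mart_diff_def
  proof (intro conjI ballI)
    fix i assume i: "i \<in> {1..n}"
    show "AE y in N. real_cond_exp N (gen_sigma N Y (i - 1)) (Y i) y = 0"
    proof (subst AE_N)
      have "AE \<omega> in M. real_cond_exp M (gen_sigma M X (i - 1)) (X i) \<omega> = real_cond_exp N (gen_sigma N Y (i - 1)) (Y i) (T \<omega>)"
        using cond_exp[OF diff_le_n[OF i] Y_int[OF i]] YT[OF i] by simp
      then show "AE \<omega> in M. real_cond_exp N (gen_sigma N Y (i - 1)) (Y i) (T \<omega>) = 0"
        using X_centred[OF i] by eventually_elim simp
      show "{y \<in> space ?P. real_cond_exp N (gen_sigma N Y (i - 1)) (Y i) y = 0} \<in> sets ?P"
        using ce_meas by measurable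
    qed
  qed (use Y_meas_N Y_sq N.prob_space_axioms in auto)
  have s2_eq: "s2 N n Y = s2 M n X"
    unfolding s2_def
  proof (rule sum.cong[OF refl])
    fix i assume "i \<in> {1..n}"
    then show "(\<integral>y. (Y i y)\<^sup>2 \<partial>N) = (\<integral>\<omega>. (X i \<omega>)\<^sup>2 \<partial>M)"
      using Y_meas[of i] by (subst integral_N) (auto simp: YT)
  qed
  then have s_eq: "s_norm N n Y = s_norm M n X" by (simp add: s_norm_def)
  have V2_eq: "AE \<omega> in M. V2 N n Y (T \<omega>) = V2 M n X \<omega>"
  proof -
    have "AE \<omega> in M. \<forall>i\<in>{1..n}. real_cond_exp M (gen_sigma M X (i - 1)) (\<lambda>\<omega>. (X i \<omega>)\<^sup>2) \<omega>
        = real_cond_exp N (gen_sigma N Y (i - 1)) (\<lambda>y. (Y i y)\<^sup>2) (T \<omega>)"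
    proof (rule AE_finite_allI)
      fix i assume i: "i \<in> {1..n}"
      show "AE \<omega> in M. real_cond_exp M (gen_sigma M X (i - 1)) (\<lambda>\<omega>. (X i \<omega>)\<^sup>2) \<omega>
        = real_cond_exp N (gen_sigma N Y (i - 1)) (\<lambda>y. (Y i y)\<^sup>2) (T \<omega>)"
        using cond_exp[OF diff_le_n[OF i] Y_sq[OF i]] YT[OF i] by simp
    qed simp
    then show ?thesis by eventually_elim (simp add: V2_def s2_eq)
  qed
  have V2_meas: "V2 N n Y \<in> borel_measurable ?P"
    unfolding V2_def[abs_def] using ce_meas by (intro borel_measurable_divide borel_measurable_sum) auto
  have V2_meas_M: "V2 M n X \<in> borel_measurable M"
    unfolding V2_def[abs_def] by measurable
  have Lp_eq: "Lp_norm p N (\<lambda>y. V2 N n Y y - 1) = Lp_norm p M (\<lambda>\<omega>. V2 M n X \<omega> - 1)"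
  proof -
    have "(\<integral>y. \<bar>V2 N n Y y - 1\<bar> powr p \<partial>N) = (\<integral>\<omega>. \<bar>V2 N n Y (T \<omega>) - 1\<bar> powr p \<partial>M)"
      using V2_meas by (intro integral_N) measurable
    also have "\<dots> = (\<integral>\<omega>. \<bar>V2 M n X \<omega> - 1\<bar> powr p \<partial>M)"
    proof (rule integral_cong_AE)
      show "AE \<omega> in M. \<bar>V2 N n Y (T \<omega>) - 1\<bar> powr p = \<bar>V2 M n X \<omega> - 1\<bar> powr p"
        using V2_eq by eventually_elim simp
    qed (use V2_meas_M measurable_compose[OF T V2_meas] in measurable)
    finally show ?thesis by (simp add: Lp_norm_def)
  qed
  have D_eq: "D_dist N n Y = D_dist M n X"
  proof -
    have "measure N {y \<in> space N. S_sum n Y y / s_norm N n Y \<le> t}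
      = measure M {\<omega> \<in> space M. S_sum n X \<omega> / s_norm M n X \<le> t}" for t
    proof -
      have S: "S_sum n Y (T \<omega>) = S_sum n X \<omega>" for \<omega> by (simp add: S_sum_def YT)
      have "S_sum n Y \<in> borel_measurable ?P"
        unfolding S_sum_def[abs_def] using Y_meas by (intro borel_measurable_sum)
      then have "{y \<in> space ?P. S_sum n Y y / s_norm N n Y \<le> t} \<in> sets ?P" by measurable
      then have "measure N {y \<in> space ?P. S_sum n Y y / s_norm N n Y \<le> t}
        = measure M (T -` {y \<in> space ?P. S_sum n Y y / s_norm N n Y \<le> t} \<inter> space M)"
        unfolding N_def by (rule measure_distr[OF T])
      also have "T -` {y \<in> space ?P. S_sum n Y y / s_norm N n Y \<le> t} \<inter> space M
        = {\<omega> \<in> space M. S_sum n X \<omega> / s_norm M n X \<le> t}"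
        by (auto simp: S s_eq space_PiM)
      finally show ?thesis by (simp add: space_N space_PiM)
    qed
    then show ?thesis by (simp add: D_dist_def)
  qed
  have bound_N: "seq_Linf_norm N n Y \<le> ereal \<gamma>"
    unfolding seq_Linf_norm_def
  proof (rule Max.boundedI)
    fix a assume "a \<in> (\<lambda>i. Linf_norm N (Y i)) ` {1..n}"
    then obtain i where i: "i \<in> {1..n}" "a = Linf_norm N (Y i)" by auto
    have "AE y in N. \<bar>Y i y\<bar> \<le> \<gamma>"
      using bound_X[OF i(1)] YT[OF i(1)] Y_meas[of i] by (subst AE_N) auto
    then show "a \<le> ereal \<gamma>"
      unfolding i(2) Linf_norm_def using Y_meas_N[of i] by (intro esssup_I) auto
  qed (use n in auto)
  show "D_dist M n X \<le> C * (real n * ln (real n) / s_norm M n X ^ 3 +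
          (Lp_norm p M (\<lambda>\<omega>. V2 M n X \<omega> - 1) powr p + s_norm M n X powr (- 2 * p))
            powr (1 / (2 * p + 1)))"
    using C[unfolded rate_bound_def, rule_format, OF n mart _ bound_N] s
    unfolding D_eq s_eq Lp_eq by blast
qed

section \<open>The rate\<close>

text \<open>
  The dyadic decomposition needs \<open>J\<close> of the order of \<open>log z\<close>, which is bounded by a multiple
  of any positive power of \<open>z\<close>.
\<close>

lemma dyadic_level:
  fixes z p :: real
  assumes "1 \<le> z" "1 \<le> p"
  obtains J :: nat where "z \<le> 2 ^ J" "real J + 1 \<le> (4 * p + 4) * z powr (1 / (2 * p + 1))"
proof
  define J where "J = nat \<lceil>log 2 z\<rceil>"
  have l: "0 \<le> log 2 z" using assms by simp
  then have J: "log 2 z \<le> real J" "real J \<le> log 2 z + 1"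
    unfolding J_def by linarith+
  have "z = 2 powr (log 2 z)" using assms by simp
  also have "\<dots> \<le> 2 powr real J" using J by simp
  finally show "z \<le> 2 ^ J" by (simp add: powr_realpow)
  have "1 / 2 \<le> ln (2::real)" using ln2_ge_two_thirds by simp
  then have "log 2 z \<le> 2 * ln z"
    using assms by (simp add: log_def divide_le_eq) (use ln_ge_zero[of z] mult_left_mono[of "1/2" "ln 2" "ln z"] in simp)
  also have "2 * ln z \<le> 2 * (z powr (1 / (2 * p + 1)) / (1 / (2 * p + 1)))"
    using ln_powr_bound[of z "1 / (2 * p + 1)"] assms by simp
  finally have "real J + 1 \<le> 2 + (4 * p + 2) * z powr (1 / (2 * p + 1))"
    using J by (simp add: algebra_simps)
  also have "\<dots> \<le> 2 * z powr (1 / (2 * p + 1)) + (4 * p + 2) * z powr (1 / (2 * p + 1))"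
    using assms ge_one_powr_ge_zero[of z "1 / (2 * p + 1)"] by simp
  finally show "real J + 1 \<le> (4 * p + 4) * z powr (1 / (2 * p + 1))" by (simp add: algebra_simps)
qed

lemma D_dist_le_1:
  assumes "prob_space M" shows "D_dist M n X \<le> 1"
proof -
  interpret prob_space M by fact
  show ?thesis
    unfolding D_dist_def
  proof (rule cSUP_least)
    fix t
    show "\<bar>prob {\<omega> \<in> space M. S_sum n X \<omega> / s_norm M n X \<le> t} - Phi t\<bar> \<le> 1"
      using prob_le_1[of "{\<omega> \<in> space M. S_sum n X \<omega> / s_norm M n X \<le> t}"]
        measure_nonneg[of M "{\<omega> \<in> space M. S_sum n X \<omega> / s_norm M n X \<le> t}"]
        std_normal.cdf_bounded_prob[of t] std_normal.cdf_nonneg[of t]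
      by linarith
  qed simp
qed

text \<open>
  If \<open>s\<close> is smaller than \<open>2\<^sup>2\<^sup>5 \<gamma>\<close>, then \<open>x \<ge> s\<^sup>-\<^sup>a\<close>, where \<open>a = 2 p / (2 p + 1)\<close>,
  is bounded below and the trivial estimate \<open>D \<le> 1\<close> suffices. Otherwise the logarithmic term
  is at most a multiple of \<open>z\<^bsup>1/(2p+1)\<^esup> / z = z\<^sup>-\<^sup>a\<close> for \<open>z = s / \<gamma>\<close>, hence of \<open>x\<close>.
\<close>

lemma rate_bound_exists:
  assumes p: "1 \<le> p" and \<gamma>: "0 < \<gamma>"
  shows "\<exists>C>0. rate_bound TYPE('a) p \<gamma> C"
proof -
  define a where "a = 2 * p / (2 * p + 1)"
  define C where "C = (2 ^ 25 * \<gamma>) powr a + 2 ^ 39 * ((4 * p + 4) * \<gamma> powr a) + 16385"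
  have a: "0 < a" using p by (simp add: a_def)
  have C: "0 < C" using p unfolding C_def by (intro add_nonneg_pos add_nonneg_nonneg mult_nonneg_nonneg) auto
  have "rate_bound TYPE('a) p \<gamma> C"
    unfolding rate_bound_def
  proof (intro allI impI)
    fix n :: nat and M :: "'a measure" and X
    assume n: "2 \<le> n" and X: "mart_diff M n X" and s: "0 < s_norm M n X"
      and bound: "seq_Linf_norm M n X \<le> ereal \<gamma>"
    interpret prob_space M using X by (simp add: mart_diff_def)
    define s where "s = s_norm M n X"
    define v where "v = (\<integral>\<omega>. \<bar>V2 M n X \<omega> - 1\<bar> powr p \<partial>M)"
    define x where "x = (v + s powr (- 2 * p)) powr (1 / (2 * p + 1))"
    have s0: "0 < s" using s by (simp add: s_def)
    have v0: "0 \<le> v" unfolding v_def by simp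
    have v_eq: "Lp_norm p M (\<lambda>\<omega>. V2 M n X \<omega> - 1) powr p = v"
      using p v0 unfolding Lp_norm_def v_def by (simp add: powr_powr)
    have pos: "0 < v + s powr (- 2 * p)" using v0 s0 by (simp add: add_nonneg_pos)
    then have x0: "0 < x" by (simp add: x_def)
    have xp: "x powr (2 * p + 1) = v + s powr (- 2 * p)"
      using pos p by (simp add: x_def powr_powr)
    have xs: "s powr (- a) \<le> x"
    proof -
      have "s powr (- a) = (s powr (- 2 * p)) powr (1 / (2 * p + 1))"
        by (simp add: powr_powr a_def)
      also have "\<dots> \<le> x" unfolding x_def using v0 p by (intro powr_mono2) auto
      finally show ?thesis .
    qed
    have "D_dist M n X \<le> C * x"
    proof (cases "2 ^ 25 * \<gamma> \<le> s")
      case False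
      have "1 = s powr a * s powr (- a)" using s0 by (simp flip: powr_add)
      also have "\<dots> \<le> (2 ^ 25 * \<gamma>) powr a * x"
        using False s0 a xs by (intro mult_mono powr_mono2) auto
      also have "\<dots> \<le> C * x" using x0 p unfolding C_def by (intro mult_right_mono) auto
      finally show ?thesis using D_dist_le_1[OF prob_space_axioms, of n X] by linarith
    next
      case True
      have "1 \<le> s / \<gamma>" using True \<gamma> by (simp add: pos_le_divide_eq)
      then obtain J :: nat where J: "s / \<gamma> \<le> 2 ^ J" "real J + 1 \<le> (4 * p + 4) * (s / \<gamma>) powr (1 / (2 * p + 1))"
        using dyadic_level[OF _ p] by blast
      have "D_dist M n X \<le> 2 ^ 39 * (\<gamma> * (real J + 1) / s) + 16385 * x"
        unfolding s_def
      proof (rule D_dist_bound[OF X _ _ \<gamma> bound _ x0 p])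
        show "(\<integral>\<omega>. \<bar>V2 M n X \<omega> - 1\<bar> powr p \<partial>M) \<le> x powr (2 * p + 1)"
          unfolding xp v_def by simp
      qed (use True J s0 in \<open>auto simp: s_def\<close>)
      also have "\<gamma> * (real J + 1) / s \<le> (4 * p + 4) * \<gamma> powr a * x"
      proof -
        have "\<gamma> * (real J + 1) / s \<le> \<gamma> * ((4 * p + 4) * (s / \<gamma>) powr (1 / (2 * p + 1))) / s"
          using J(2) \<gamma> s0 by (intro divide_right_mono mult_left_mono) auto
        also have "\<dots> = (4 * p + 4) * ((s / \<gamma>) powr (1 / (2 * p + 1)) / (s / \<gamma>) powr 1)"
          using \<gamma> s0 by simp
        also have "(s / \<gamma>) powr (1 / (2 * p + 1)) / (s / \<gamma>) powr 1 = (s / \<gamma>) powr (- a)"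
        proof -
          have "1 / (2 * p + 1) - 1 = - a" using p by (simp add: a_def field_simps)
          then show ?thesis by (simp only: powr_diff[symmetric])
        qed
        also have "(s / \<gamma>) powr (- a) = \<gamma> powr a * s powr (- a)"
          using \<gamma> s0 by (simp add: powr_divide powr_minus field_simps)
        also have "(4 * p + 4) * (\<gamma> powr a * s powr (- a)) \<le> (4 * p + 4) * (\<gamma> powr a * x)"
          using xs p by (intro mult_left_mono) auto
        finally show ?thesis by (simp add: mult.assoc)
      qed
      finally have "D_dist M n X \<le> 2 ^ 39 * ((4 * p + 4) * \<gamma> powr a * x) + 16385 * x" by simp
      also have "\<dots> = (2 ^ 39 * ((4 * p + 4) * \<gamma> powr a) + 16385) * x" by (simp add: algebra_simps)
      also have "\<dots> \<le> C * x" using x0 unfolding C_def by (intro mult_right_mono) auto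
      finally show ?thesis .
    qed
    also have "\<dots> \<le> C * (real n * ln (real n) / s ^ 3 + x)"
      using C n s0 by (intro mult_left_mono) auto
    finally show "D_dist M n X \<le> C * (real n * ln (real n) / s_norm M n X ^ 3 +
          (Lp_norm p M (\<lambda>\<omega>. V2 M n X \<omega> - 1) powr p + s_norm M n X powr (- 2 * p))
            powr (1 / (2 * p + 1)))"
      unfolding v_eq by (simp add: x_def s_def)
  qed
  then show ?thesis using C by blast
qed

theorem theorem1p5:
  fixes p \<gamma> :: real
  assumes "1 \<le> p" and "0 < \<gamma>"
  shows "(\<exists>C>0. rate_bound TYPE(nat \<Rightarrow> real) p \<gamma> C) \<and>
         (\<forall>C>0. rate_bound TYPE(nat \<Rightarrow> real) p \<gamma> C \<longrightarrow> rate_bound TYPE('a) p \<gamma> C)"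
  using rate_bound_exists[OF assms] rate_bound_transfer by blast

end
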